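(* Let $P$ be a finite set of 1-line patterns and $H$ a finite set of permutations, and let $S^P(H)$ be the set of permutations that avoid every pattern in $P$ as a 1-line pattern and heap-avoid every element of $H$. If each element of $P'=\bigcup_{h\in H}U^P(h)$ is an ideal pattern in $S^P$, then $S^P(H)=S^{P\cup P'}$; that is, $S^P(H)$ is characterized by avoiding the permutations of $P\cup P'$ as 1-line patterns.
   Context: A permutation $w=[w_1\cdots w_n]$ contains $p\in S_k$ as a 1-line pattern if there are $i_1<\dots<i_k$ with $w_{i_a}<w_{i_b}$ iff $p_a<p_b$ for $a<b$. For a set $Q$ of patterns, $S^Q=\bigcup_n S^Q_n$ is the set of permutations avoiding all patterns in $Q$, $S^Q_n=S^Q\cap S_n$. For $p\in S_r$, $r(p)=r$. The heap of a reduced expression $\mathsf{w}_1\cdots\mathsf{w}_k$ (generators $s_i$ of $S_n$) is $\{1,\dots,k\}$ ordered by the transitive closure of $i\lessdot j$ if $i<j$ and $\mathsf{w}_i,\mathsf{w}_j$ don't commute, labeled by $\mathsf{w}_i$. An orientation preserving Coxeter embedding $f$ is an injective map $\{s_1,\dots,s_{k-1}\}\to\{s_1,\dots,s_{n-1}\}$ with $(s_is_j)^m=1\iff(f(s_i)f(s_j))^m=1$ for $m\in\{2,3\}$ and preserving the order of indices, extended to words. $w$ heap-contains $h$ if for some reduced expressions $\mathsf{w},\mathsf{h}$ and such an $f$, the heap of $f(\mathsf{h})$ is a convex labeled subposet of the heap of $\mathsf{w}$; otherwise $w$ heap-avoids $h$. $U^P(h)$ is the set of elements of $S^P_{r(h)}$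 that heap-contain $h$. $p\in S^P$ is an ideal pattern in $S^P$ if every $q\in S^P_{r(p)+1}$ containing $p$ as a 1-line pattern heap-contains $p$. *)

theory Defs
  imports "HOL-Combinatorics.Combinatorics"
begin

text \<open>A permutation is represented by its 1-line notation, a list whose entries are
  \<open>1, \<dots>, n\<close> in some order. So the groups \<open>S\<^sub>n\<close> for different \<open>n\<close> are disjoint and
  the rank \<open>r(p)\<close> is \<^term>\<open>length p\<close>.\<close>

definition Sym :: "nat \<Rightarrow> nat list set" where
  "Sym n = permutations_of_set {1..n}"

definition perms :: "nat list set" where
  "perms = (\<Union>n\<in>{1..}. Sym n)"

definition contains_pattern :: "nat list \<Rightarrow> nat list \<Rightarrow> bool" where
  "contains_pattern w p \<longleftrightarrow>
     (\<exists>i. strict_mono_on {..<length p} i \<and> i ` {..<length p} \<subseteq> {..<length w} \<and>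
          (\<forall>a b. a < b \<and> b < length p \<longrightarrow> (w ! i a < w ! i b \<longleftrightarrow> p ! a < p ! b)))"

definition Av :: "nat list set \<Rightarrow> nat list set" where
  "Av Q = {w \<in> perms. \<forall>p\<in>Q. \<not> contains_pattern w p}"

subsection \<open>Reduced expressions\<close>

definition perm_fun :: "nat list \<Rightarrow> nat \<Rightarrow> nat" where
  "perm_fun w i = (if i \<in> {1..length w} then w ! (i - 1) else i)"

definition gen :: "nat \<Rightarrow> nat \<Rightarrow> nat" where
  "gen i = transpose i (Suc i)"

text \<open>A word in the generators is the list of their indices; \<^term>\<open>{1..<n}\<close> indexes the
  generators of \<open>S\<^sub>n\<close>. Multiplying from left to right instead would reverse every reduced word
  and dualize every heap, which leaves heap containment unchanged.\<close>

definition word_prod :: "nat list \<Rightarrow> nat \<Rightarrow> nat" where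
  "word_prod u = foldr (\<circ>) (map gen u) id"

definition expression :: "nat list \<Rightarrow> nat list \<Rightarrow> bool" where
  "expression w u \<longleftrightarrow> set u \<subseteq> {1..<length w} \<and> word_prod u = perm_fun w"

definition reduced_expression :: "nat list \<Rightarrow> nat list \<Rightarrow> bool" where
  "reduced_expression w u \<longleftrightarrow>
     expression w u \<and> (\<forall>v. expression w v \<longrightarrow> length u \<le> length v)"

subsection \<open>Heaps\<close>

text \<open>The elements of the heap of a word \<open>u\<close> are the positions \<^term>\<open>{..<length u}\<close>
  (counted from 0), and \<^term>\<open>u ! i\<close> is the label of \<open>i\<close>. In a reduced word two
  occurrences of the same generator are comparable, because a generator not commuting
  with it occurs between them.\<close>

definition heap_step :: "nat list \<Rightarrow> (nat \<times> nat) set" where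
  "heap_step u = {(i, j). i < j \<and> j < length u \<and>
     gen (u ! i) \<circ> gen (u ! j) \<noteq> gen (u ! j) \<circ> gen (u ! i)}"

definition heap_le :: "nat list \<Rightarrow> (nat \<times> nat) set" where
  "heap_le u = {(i, j). i < length u \<and> j < length u \<and> (i, j) \<in> (heap_step u)\<^sup>*}"

definition convex_labeled_subheap :: "nat list \<Rightarrow> nat list \<Rightarrow> bool" where
  "convex_labeled_subheap v u \<longleftrightarrow>
     (\<exists>g. inj_on g {..<length v} \<and> g ` {..<length v} \<subseteq> {..<length u} \<and>
          (\<forall>i<length v. u ! g i = v ! i) \<and>
          (\<forall>i<length v. \<forall>j<length v. (i, j) \<in> heap_le v \<longleftrightarrow> (g i, g j) \<in> heap_le u) \<and>
          (\<forall>x\<in>g ` {..<length v}. \<forall>z\<in>g ` {..<length v}. \<forall>y.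
             (x, y) \<in> heap_le u \<and> (y, z) \<in> heap_le u \<longrightarrow> y \<in> g ` {..<length v}))"

subsection \<open>Heap containment\<close>

text \<open>Orientation preserving Coxeter embeddings of the generators of \<open>S\<^sub>k\<close> into those
  of \<open>S\<^sub>n\<close>, as maps on indices.\<close>

definition coxeter_embedding :: "nat \<Rightarrow> nat \<Rightarrow> (nat \<Rightarrow> nat) \<Rightarrow> bool" where
  "coxeter_embedding k n f \<longleftrightarrow>
     f ` {1..<k} \<subseteq> {1..<n} \<and> inj_on f {1..<k} \<and>
     (\<forall>i\<in>{1..<k}. \<forall>j\<in>{1..<k}. \<forall>m\<in>{2, 3}.
        (gen i \<circ> gen j) ^^ m = id \<longleftrightarrow> (gen (f i) \<circ> gen (f j)) ^^ m = id) \<and>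
     (\<forall>i\<in>{1..<k}. \<forall>j\<in>{1..<k}. i < j \<longrightarrow> f i < f j)"

definition heap_contains :: "nat list \<Rightarrow> nat list \<Rightarrow> bool" where
  "heap_contains w h \<longleftrightarrow>
     (\<exists>u v f. reduced_expression w u \<and> reduced_expression h v \<and>
        coxeter_embedding (length h) (length w) f \<and>
        convex_labeled_subheap (map f v) u)"

definition heap_Av :: "nat list set \<Rightarrow> nat list set \<Rightarrow> nat list set" where
  "heap_Av P H = {w \<in> Av P. \<forall>h\<in>H. \<not> heap_contains w h}"

definition U :: "nat list set \<Rightarrow> nat list \<Rightarrow> nat list set" where
  "U P h = {w \<in> Av P \<inter> Sym (length h). heap_contains w h}"

definition ideal_pattern :: "nat list set \<Rightarrow> nat list \<Rightarrow> bool" where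
  "ideal_pattern P p \<longleftrightarrow>
     p \<in> Av P \<and>
     (\<forall>q \<in> Av P \<inter> Sym (length p + 1). contains_pattern q p \<longrightarrow> heap_contains q p)"

end

theory Submission
  imports Defs
begin

text \<open>By linear extensions of heaps, \<open>w\<close> heap-contains \<open>h\<close> iff \<open>w\<close> has a reduced word
  with a factor that is a shifted reduced word of \<open>h\<close>. Following the letters outside the factor,
  such a \<open>w\<close> contains as a 1-line pattern some \<open>p\<close> of the size of \<open>h\<close> which itself
  heap-contains \<open>h\<close>, at positions that are convex: no further point \<open>(j, w j)\<close> lies to the
  north-east of one point of the occurrence and to the south-west of another. Conversely, a convex
  occurrence of \<open>p\<close> in \<open>w\<close> makes a reduced word of \<open>p\<close> a factor of one of \<open>w\<close>.

  Let \<open>w\<close> contain some \<open>p \<in> U P h\<close>. If the occurrence is not convex, add to it a point of its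
  convex hull. The pattern of the enlarged set heap-contains \<open>p\<close> by ideality, so it has a convex
  occurrence of another element of \<open>U P h\<close>, which omits one of the points and has a strictly
  smaller hull in \<open>w\<close>. Repeating this ends with a convex occurrence.\<close>

text \<open>Both directions rest on the dominance order of the points \<open>(a, F a)\<close>: its
  comparable pairs are exactly the non-inversions of \<open>F\<close>. Up to renaming positions, a
  letter that lengthens a word destroys one comparable pair and creates none, so a convex set stays
  convex while letters are added around a factor. Conversely, a convex set can be contracted to a
  single element of this poset, and a linear extension of the quotient dictates which descents of
  \<open>F\<close> to strip until only the block remains.

  Ideality concerns a single extra point and does not say which pattern is found afterwards: the
  occurrence obtained from the enlarged set may belong to another element of \<open>U P h\<close>.
  The descent therefore runs over all occurrences of all elements of \<open>U P h\<close>, measured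
  by the hull in \<open>w\<close>, which does not refer to the pattern. Transitivity of factor
  containment is what keeps the new pattern inside \<open>U P h\<close>.\<close>

section \<open>Adjacent transpositions, products of words and their shifts\<close>

lemma gen_gen [simp]: "gen i (gen i x) = x"
  by (simp add: gen_def)

lemma gen_apply: "gen i x = (if x = i then Suc i else if x = Suc i then i else x)"
  unfolding gen_def transpose_def by (rule refl)

lemma gen_self [simp]: "gen i i = Suc i" "gen i (Suc i) = i"
  by (simp_all add: gen_apply)

lemma gen_comp_gen: "gen i \<circ> (gen i \<circ> f) = f" "(f \<circ> gen i) \<circ> gen i = f"
  by (auto simp: fun_eq_iff)

text \<open>The source of all length and convexity arguments: one letter affects the order of
  values, or of positions, in a single place.\<close>

lemma gen_less_iff:
  "x < y \<Longrightarrow> gen i x < gen i y \<longleftrightarrow> \<not> (x = i \<and> y = Suc i)"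
  unfolding gen_apply by (auto split: if_splits)

lemma gen_permutes: "i \<in> {1..<n} \<Longrightarrow> gen i permutes {1..n}"
  unfolding gen_def by (rule permutes_swap_id) auto

lemma word_prod_Cons: "word_prod (i # u) = gen i \<circ> word_prod u"
  by (simp add: word_prod_def)

lemma word_prod_Nil: "word_prod [] = id"
  by (simp add: word_prod_def)

lemma word_prod_append: "word_prod (u @ v) = word_prod u \<circ> word_prod v"
  by (induction u) (simp_all add: word_prod_Nil word_prod_Cons comp_assoc)

lemma word_prod_snoc: "word_prod (u @ [i]) = word_prod u \<circ> gen i"
  by (simp add: word_prod_append word_prod_Cons word_prod_Nil)

lemma word_prod_permutes: "set u \<subseteq> {1..<n} \<Longrightarrow> word_prod u permutes {1..n}"
proof (induction u)
  case Nil
  show ?case unfolding word_prod_Nil by (rule permutes_id)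
next
  case (Cons i u)
  then have "word_prod u permutes {1..n}" "i \<in> {1..<n}"
    by auto
  then show ?case
    unfolding word_prod_Cons by (intro permutes_compose gen_permutes)
qed

lemma word_prod_shift: "word_prod (map (\<lambda>i. i + c) v) (a + c) = word_prod v a + c"
proof (induction v)
  case (Cons i v)
  then show ?case by (simp add: word_prod_Cons) (simp add: gen_apply)
qed (simp add: word_prod_Nil)

text \<open>A letter \<open>0\<close> would be shifted to \<open>c\<close>, which moves the point
  \<open>c\<close> itself; this is why it is excluded.\<close>

lemma word_prod_shift_below:
  "0 \<notin> set v \<Longrightarrow> a \<le> c \<Longrightarrow> word_prod (map (\<lambda>i. i + c) v) a = a"
proof (induction v)
  case (Cons i v)
  then show ?case by (simp add: word_prod_Cons) (simp add: gen_apply)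
qed (simp add: word_prod_Nil)
subsection \<open>Inversions and reduced words\<close>

definition inversions :: "(nat \<Rightarrow> nat) \<Rightarrow> (nat \<times> nat) set" where
  "inversions f = {(a, b). a < b \<and> f b < f a}"

definition ell :: "(nat \<Rightarrow> nat) \<Rightarrow> nat" where
  "ell f = card (inversions f)"

text \<open>Reducedness is measured by inversions instead of minimality, so that it can be tested
  letter by letter. The agreement with minimal length is
  \<open>reduced_expression_iff\<close>.\<close>

definition reduced_word :: "nat \<Rightarrow> nat list \<Rightarrow> bool" where
  "reduced_word n u \<longleftrightarrow> set u \<subseteq> {1..<n} \<and> ell (word_prod u) = length u"

text \<open>Points outside \<open>{1..n}\<close> are fixed and points inside stay inside, so a pair
  with an endpoint outside keeps its order.\<close>

lemma finite_inversions:
  assumes "f permutes {1..n}"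
  shows "finite (inversions f)"
proof (rule finite_subset)
  show "inversions f \<subseteq> {1..n} \<times> {1..n}"
  proof
    fix p assume "p \<in> inversions f"
    then obtain a b where p: "p = (a, b)" and ab: "a < b" "f b < f a"
      by (auto simp: inversions_def)
    have out: "f x = x" if "x \<notin> {1..n}" for x
      using permutes_not_in[OF assms that] .
    have ins: "1 \<le> f x \<and> f x \<le> n" if "x \<in> {1..n}" for x
      using permutes_in_image[OF assms, of x] that by auto
    show "p \<in> {1..n} \<times> {1..n}"
      using p ab out[of a] out[of b] ins[of a] ins[of b]
      by (cases "a \<in> {1..n}"; cases "b \<in> {1..n}") auto
  qed
qed auto

text \<open>A letter on the left exchanges two values, so only the positions \<open>s\<close> and
  \<open>t\<close> carrying them change their relative order, and all other inversions remain the
  same pairs.\<close>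

lemma ell_gen_comp:
  assumes f: "f permutes {1..n}" and "f s = i" "f t = Suc i" "s < t"
  shows "ell (gen i \<circ> f) = Suc (ell f)"
proof -
  have inj: "f x = f y \<longleftrightarrow> x = y" for x y
    using permutes_inj[OF f] by (simp add: inj_eq)
  have key: "gen i (f b) < gen i (f a) \<longleftrightarrow> a = s \<and> b = t \<or> f b < f a" if "a < b" for a b
  proof (cases "f a < f b")
    case True
    then have "gen i (f a) < gen i (f b) \<longleftrightarrow> \<not> (f a = i \<and> f b = Suc i)"
      by (rule gen_less_iff)
    moreover have "f a = i \<longleftrightarrow> a = s" "f b = Suc i \<longleftrightarrow> b = t"
      using inj assms(2,3) by metis+
    moreover have "gen i (f a) \<noteq> gen i (f b)"
      using True by (metis gen_gen less_irrefl)
    ultimately show ?thesis using True by auto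
  next
    case False
    then have lt: "f b < f a" using inj[of a b] that by auto
    then have "gen i (f b) < gen i (f a) \<longleftrightarrow> \<not> (f b = i \<and> f a = Suc i)"
      by (rule gen_less_iff)
    moreover have "\<not> (f b = i \<and> f a = Suc i)"
      using inj[of b s] inj[of a t] assms(2-4) that by auto
    ultimately show ?thesis using lt by simp
  qed
  have "inversions (gen i \<circ> f) = insert (s, t) (inversions f)"
    using key assms(4) by (auto simp: inversions_def)
  moreover have "(s, t) \<notin> inversions f"
    using assms by (simp add: inversions_def)
  ultimately show ?thesis
    using finite_inversions[OF f] by (simp add: ell_def)
qed

text \<open>A letter on the right exchanges two positions: the old inversions are renamed by
  \<open>gen i\<close> in both coordinates, and the pair \<open>(i, Suc i)\<close> is new.\<close>

lemma ell_comp_gen: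
  assumes f: "f permutes {1..n}" and "f i < f (Suc i)"
  shows "ell (f \<circ> gen i) = Suc (ell f)"
proof -
  let ?g = "map_prod (gen i) (gen i)"
  have gg: "?g (?g p) = p" for p
    by (cases p) simp
  have "inversions (f \<circ> gen i) = insert (i, Suc i) (?g ` inversions f)"
  proof (intro set_eqI)
    fix p :: "nat \<times> nat"
    have "p \<in> ?g ` inversions f \<longleftrightarrow> ?g p \<in> inversions f"
      by (metis gg imageE imageI)
    then show "p \<in> inversions (f \<circ> gen i) \<longleftrightarrow> p \<in> insert (i, Suc i) (?g ` inversions f)"
      using assms(2) by (cases p) (auto simp: inversions_def gen_apply split: if_splits)
  qed
  moreover have "(i, Suc i) \<notin> ?g ` inversions f"
    by (auto simp: inversions_def gen_apply split: if_splits)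
  moreover have "card (?g ` inversions f) = card (inversions f)"
    by (rule card_image) (metis gg inj_onI)
  ultimately show ?thesis
    using finite_inversions[OF f] by (simp add: ell_def)
qed

lemma ell_gen_comp_descent:
  assumes f: "f permutes {1..n}" and i: "i \<in> {1..<n}" and "f s = Suc i" "f t = i" "s < t"
  shows "ell f = Suc (ell (gen i \<circ> f))"
  using ell_gen_comp[OF permutes_compose[OF f gen_permutes[OF i]], of s i t] assms(3-)
  by (simp add: gen_apply gen_comp_gen)

lemma ell_comp_gen_descent:
  assumes f: "f permutes {1..n}" and i: "i \<in> {1..<n}" and "f (Suc i) < f i"
  shows "ell f = Suc (ell (f \<circ> gen i))"
  using ell_comp_gen[OF permutes_compose[OF gen_permutes[OF i] f], of i] assms(3)
  by (simp add: gen_apply gen_comp_gen)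

lemma ell_gen_comp_le:
  assumes f: "f permutes {1..n}" and i: "i \<in> {1..<n}"
  shows "ell (gen i \<circ> f) \<le> Suc (ell f)"
proof -
  obtain s t where st: "f s = i" "f t = Suc i"
    using permutes_surj[OF f] by (metis surjD)
  then have "s \<noteq> t" by auto
  then show ?thesis
    using ell_gen_comp[OF f st] ell_gen_comp_descent[OF f i st(2,1)] by linarith
qed

lemma ell_comp_gen_le:
  assumes f: "f permutes {1..n}" and i: "i \<in> {1..<n}"
  shows "ell (f \<circ> gen i) \<le> Suc (ell f)"
proof -
  have "f i \<noteq> f (Suc i)"
    using permutes_inj[OF f] by (simp add: inj_eq)
  then show ?thesis
    using ell_comp_gen[OF f, of i] ell_comp_gen_descent[OF f i] by linarith
qed

lemma ell_id [simp]: "ell id = 0"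
  unfolding ell_def inversions_def by (rule card_eq_0_iff[THEN iffD2]) auto

lemma ell_word_prod_le: "set u \<subseteq> {1..<n} \<Longrightarrow> ell (word_prod u) \<le> length u"
proof (induction u)
  case (Cons i u)
  then have "ell (gen i \<circ> word_prod u) \<le> Suc (ell (word_prod u))" "ell (word_prod u) \<le> length u"
    using ell_gen_comp_le[OF word_prod_permutes[of u n], of i] by auto
  then have "ell (gen i \<circ> word_prod u) \<le> length (i # u)"
    by simp
  then show ?case
    by (simp only: word_prod_Cons)
qed (simp add: word_prod_Nil)

text \<open>A letter raises the length by at most one, so a word attaining the maximal number of
  inversions leaves no slack in its tail.\<close>

lemma reduced_word_ConsD:
  assumes "reduced_word n (i # u)"
  shows "reduced_word n u"
proof -
  have u: "set u \<subseteq> {1..<n}" "i \<in> {1..<n}" and l: "ell (gen i \<circ> word_prod u) = Suc (length u)"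
    using assms unfolding reduced_word_def word_prod_Cons by auto
  show ?thesis
    using ell_gen_comp_le[OF word_prod_permutes[OF u(1)] u(2)] ell_word_prod_le[OF u(1)] l u(1)
    unfolding reduced_word_def by simp
qed

lemma reduced_word_snocD:
  assumes "reduced_word n (u @ [i])"
  shows "reduced_word n u"
proof -
  have u: "set u \<subseteq> {1..<n}" "i \<in> {1..<n}" and l: "ell (word_prod u \<circ> gen i) = Suc (length u)"
    using assms unfolding reduced_word_def word_prod_snoc by auto
  show ?thesis
    using ell_comp_gen_le[OF word_prod_permutes[OF u(1)] u(2)] ell_word_prod_le[OF u(1)] l u(1)
    unfolding reduced_word_def by simp
qed

lemma reduced_word_Cons_iff:
  assumes "reduced_word n u" "i \<in> {1..<n}" "word_prod u s = i" "word_prod u t = Suc i"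
  shows "reduced_word n (i # u) \<longleftrightarrow> s < t"
proof -
  have f: "word_prod u permutes {1..n}"
    using assms(1) unfolding reduced_word_def by (blast intro: word_prod_permutes)
  have "s \<noteq> t" using assms by auto
  then show ?thesis
    using assms(1,2) ell_gen_comp[OF f assms(3,4)] ell_gen_comp_descent[OF f assms(2,4,3)]
    unfolding reduced_word_def word_prod_Cons by (cases "s < t") auto
qed

lemma reduced_word_snoc_iff:
  assumes "reduced_word n u" "i \<in> {1..<n}"
  shows "reduced_word n (u @ [i]) \<longleftrightarrow> word_prod u i < word_prod u (Suc i)"
proof -
  have f: "word_prod u permutes {1..n}"
    using assms(1) unfolding reduced_word_def by (blast intro: word_prod_permutes)
  have "word_prod u i \<noteq> word_prod u (Suc i)"
    using permutes_inj[OF f] by (simp add: inj_eq)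
  then show ?thesis
    using assms ell_comp_gen[OF f, of i] ell_comp_gen_descent[OF f assms(2)]
    unfolding reduced_word_def word_prod_snoc
    by (cases "word_prod u i < word_prod u (Suc i)") auto
qed

text \<open>Shifting embeds the inversion set of \<open>word_prod v\<close>, which bounds the length
  from below; \<open>ell_word_prod_le\<close> bounds it from above.\<close>

lemma reduced_word_shift:
  assumes "reduced_word k v" "k + c \<le> n"
  shows "reduced_word n (map (\<lambda>i. i + c) v)"
proof -
  let ?f = "word_prod (map (\<lambda>i. i + c) v)"
  have set: "set (map (\<lambda>i. i + c) v) \<subseteq> {1..<n}"
    using assms by (force simp: reduced_word_def)
  have "(\<lambda>(a, b). (a + c, b + c)) ` inversions (word_prod v) \<subseteq> inversions ?f"
    by (auto simp: inversions_def word_prod_shift)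
  then have "card ((\<lambda>(a, b). (a + c, b + c)) ` inversions (word_prod v)) \<le> ell ?f"
    unfolding ell_def by (intro card_mono finite_inversions[OF word_prod_permutes[OF set]])
  moreover have "card ((\<lambda>(a, b). (a + c, b + c)) ` inversions (word_prod v)) = length v"
    using assms(1) by (subst card_image) (auto simp: inj_on_def ell_def reduced_word_def)
  ultimately show ?thesis
    using ell_word_prod_le[OF set] set by (simp add: reduced_word_def)
qed

section \<open>How a letter acts on an increasing sequence of positions or values\<close>

text \<open>The only pair reversed by \<open>gen i\<close> is missing from the image. This is the
  case of a letter that moves at most one point of an occurrence and so leaves the pattern
  unchanged.\<close>

lemma strict_mono_on_gen_comp:
  assumes "strict_mono_on S \<beta>" "\<not> (i \<in> \<beta> ` S \<and> Suc i \<in> \<beta> ` S)"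
  shows "strict_mono_on S (gen i \<circ> \<beta>)"
proof (rule strict_mono_onI)
  fix a b assume ab: "a \<in> S" "b \<in> S" "a < b"
  then have "\<beta> a < \<beta> b" using assms(1) by (auto dest: strict_mono_onD)
  moreover have "\<not> (\<beta> a = i \<and> \<beta> b = Suc i)" using assms(2) ab by (metis imageI)
  ultimately show "(gen i \<circ> \<beta>) a < (gen i \<circ> \<beta>) b" by (simp add: gen_less_iff)
qed

text \<open>The complementary case: \<open>i\<close> and \<open>Suc i\<close> can only come from
  neighbouring arguments, and the letter \<open>i\<close> acts on the sequence as the letter
  \<open>a\<close> acts on the pattern.\<close>

lemma strict_mono_on_consecutive:
  fixes \<beta> :: "nat \<Rightarrow> nat"
  assumes "strict_mono_on {1..k} \<beta>" "i \<in> \<beta> ` {1..k}" "Suc i \<in> \<beta> ` {1..k}"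
  obtains a where "a \<in> {1..<k}" "\<beta> a = i" "\<beta> (Suc a) = Suc i"
    "\<And>b. b \<in> {1..k} \<Longrightarrow> gen i (\<beta> b) = \<beta> (gen a b)"
proof -
  obtain a b where ab: "a \<in> {1..k}" "b \<in> {1..k}" "\<beta> a = i" "\<beta> b = Suc i"
    using assms by (metis imageE)
  have mono: "\<beta> x < \<beta> y \<longleftrightarrow> x < y" if "x \<in> {1..k}" "y \<in> {1..k}" for x y
    using strict_mono_on_less[OF assms(1) that] .
  have "a < b" using ab mono[of a b] by auto
  moreover have "\<not> Suc a < b"
    using ab mono[of a "Suc a"] mono[of "Suc a" b] by auto
  ultimately have b: "b = Suc a" by simp
  have eq: "\<beta> x = \<beta> y \<longleftrightarrow> x = y" if "x \<in> {1..k}" "y \<in> {1..k}" for x y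
    using strict_mono_on_eqD[OF assms(1)] that by auto
  show ?thesis
  proof (rule that[of a])
    fix x assume "x \<in> {1..k}"
    then show "gen i (\<beta> x) = \<beta> (gen a x)"
      using ab b eq[of x a] eq[of x b] by (auto simp: gen_apply)
  qed (use ab b in auto)
qed

subsection \<open>From factors of reduced words to convex occurrences\<close>

definition dominance_convex :: "(nat \<Rightarrow> nat) \<Rightarrow> nat set \<Rightarrow> bool" where
  "dominance_convex F A \<longleftrightarrow>
     (\<forall>a\<in>A. \<forall>b\<in>A. \<forall>j. a < j \<and> j < b \<and> F a < F j \<and> F j < F b \<longrightarrow> j \<in> A)"

text \<open>The dominance order only loses the relation between \<open>s\<close> and
  \<open>t\<close>. A chain in the smaller order is a chain in the larger one, so convexity is
  inherited.\<close>

lemma dominance_convex_gen_comp: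
  assumes F: "dominance_convex F A" and st: "F s = i" "F t = Suc i" "s < t"
    and inj: "inj F"
  shows "dominance_convex (gen i \<circ> F) A"
proof -
  have less: "F a < F b" if "a < b" "gen i (F a) < gen i (F b)" for a b
  proof (rule ccontr)
    assume "\<not> F a < F b"
    with that have lt: "F b < F a" using inj_eq[OF inj, of a b] by (metis less_irrefl linorder_neqE_nat)
    then have "F b = i \<and> F a = Suc i"
      using gen_less_iff[OF lt, of i] that by auto
    then have "b = s" "a = t" using st inj by (metis injD)+
    then show False using that st by simp
  qed
  show ?thesis
    unfolding dominance_convex_def o_def
  proof (intro ballI allI impI; elim conjE)
    fix a b j
    assume "a \<in> A" "b \<in> A" "a < j" "j < b" "gen i (F a) < gen i (F j)" "gen i (F j) < gen i (F b)"
    then show "j \<in> A"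
      using F less[of a j] less[of j b] unfolding dominance_convex_def by blast
  qed
qed

text \<open>As for letters on the left, except that positions are renamed, so the set moves along
  with them.\<close>

lemma dominance_convex_comp_gen:
  assumes F: "dominance_convex F A" and lt: "F i < F (Suc i)"
  shows "dominance_convex (F \<circ> gen i) (gen i ` A)"
  unfolding dominance_convex_def o_def
proof (intro ballI allI impI; elim conjE)
  have less: "gen i a < gen i b" if "a < b" "F (gen i a) < F (gen i b)" for a b
    using gen_less_iff[OF that(1), of i] that(2) lt by auto
  fix a b j
  assume "a \<in> gen i ` A" "b \<in> gen i ` A" and *: "a < j" "j < b"
    "F (gen i a) < F (gen i j)" "F (gen i j) < F (gen i b)"
  then have "gen i a \<in> A" "gen i b \<in> A" by auto
  then have "gen i j \<in> A"
    using F less[of a j] less[of j b] * unfolding dominance_convex_def by blast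
  then show "j \<in> gen i ` A" by (metis gen_gen imageI)
qed

lemma gen_in_range: "i \<in> {1..<n} \<Longrightarrow> gen i a \<in> {1..n} \<longleftrightarrow> a \<in> {1..n}"
  using permutes_in_image[OF gen_permutes] .

text \<open>Letters are added around the bare factor, on the right and then on the left.
  \<open>\<alpha>\<close> lists the positions and \<open>\<beta>\<close> the values of the
  occurrence in increasing order. A letter exchanging two of its points is recorded in
  \<open>x'\<close> or \<open>y'\<close>; any other letter is absorbed into \<open>\<alpha>\<close>
  (right) or \<open>\<beta>\<close> (left).\<close>

lemma factor_convex_occurrence:
  assumes "reduced_word n (x @ map (\<lambda>i. i + c) v @ y)" "reduced_word k v" "k + c \<le> n"
  shows "\<exists>\<alpha> \<beta> x' y'. strict_mono_on {1..k} \<alpha> \<and> \<alpha> ` {1..k} \<subseteq> {1..n} \<and>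
    strict_mono_on {1..k} \<beta> \<and> reduced_word k (x' @ v @ y') \<and>
    (\<forall>a\<in>{1..k}. word_prod (x @ map (\<lambda>i. i + c) v @ y) (\<alpha> a) = \<beta> (word_prod (x' @ v @ y') a)) \<and>
    dominance_convex (word_prod (x @ map (\<lambda>i. i + c) v @ y)) (\<alpha> ` {1..k})"
  (is "\<exists>\<alpha> \<beta> x' y'. ?occ x y \<alpha> \<beta> x' y'")
  using assms(1)
proof (induction x)
  case Nil
  then show ?case
  proof (induction y rule: rev_induct)
    case Nil
    let ?\<alpha> = "\<lambda>a. a + c"
    \<comment> \<open>The positions \<open>c + 1, ..., c + k\<close> form an interval, which is
      convex whatever the values are.\<close>
    have "dominance_convex (word_prod (map (\<lambda>i. i + c) v)) (?\<alpha> ` {1..k})"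
      unfolding dominance_convex_def by (auto simp: image_iff)
    then have "?occ [] [] ?\<alpha> ?\<alpha> [] []"
      using assms by (auto simp: word_prod_shift strict_mono_on_def)
    then show ?case by blast
  next
    case (snoc i y)
    let ?z = "[] @ map (\<lambda>i. i + c) v @ y"
    have red': "reduced_word n (?z @ [i])" using snoc.prems by simp
    then have red: "reduced_word n ?z" and i: "i \<in> {1..<n}"
      using reduced_word_snocD by (blast, simp add: reduced_word_def)
    let ?F = "word_prod ?z"
    have lt: "?F i < ?F (Suc i)"
      using reduced_word_snoc_iff[OF red i] red' by simp
    from snoc.IH[OF red] obtain \<alpha> \<beta> x' y' where
      \<alpha>: "strict_mono_on {1..k} \<alpha>" "\<alpha> ` {1..k} \<subseteq> {1..n}" and \<beta>: "strict_mono_on {1..k} \<beta>"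
      and p: "reduced_word k (x' @ v @ y')"
      and eq: "\<And>a. a \<in> {1..k} \<Longrightarrow> ?F (\<alpha> a) = \<beta> (word_prod (x' @ v @ y') a)"
      and cvx: "dominance_convex ?F (\<alpha> ` {1..k})"
      by blast
    let ?F' = "word_prod ([] @ map (\<lambda>i. i + c) v @ y @ [i])"
    have F': "?F' = ?F \<circ> gen i"
      using word_prod_snoc[of ?z i] by simp
    have cvx': "dominance_convex ?F' (gen i ` \<alpha> ` {1..k})"
      unfolding F' by (rule dominance_convex_comp_gen[OF cvx lt])
    show ?case
    proof (cases "i \<in> \<alpha> ` {1..k} \<and> Suc i \<in> \<alpha> ` {1..k}")
      case True
      then obtain a where a: "a \<in> {1..<k}" "\<alpha> a = i" "\<alpha> (Suc a) = Suc i"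
        and comm: "\<And>b. b \<in> {1..k} \<Longrightarrow> gen i (\<alpha> b) = \<alpha> (gen a b)"
        using strict_mono_on_consecutive[OF \<alpha>(1)] by metis
      let ?P = "word_prod (x' @ v @ y')"
      have P: "?P permutes {1..k}"
        using p unfolding reduced_word_def by (blast intro: word_prod_permutes)
      \<comment> \<open>Since \<open>\<beta>\<close> is increasing, the ascent of \<open>?F\<close>
        at \<open>i\<close> is an ascent of the pattern at \<open>a\<close>; so the recorded word
        stays reduced.\<close>
      have "\<beta> (?P a) < \<beta> (?P (Suc a))"
        using lt eq[of a] eq[of "Suc a"] a by auto
      then have "?P a < ?P (Suc a)"
        using strict_mono_on_less[OF \<beta>, of "?P a" "?P (Suc a)"] permutes_in_image[OF P, of a]
          permutes_in_image[OF P, of "Suc a"] a by auto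
      then have "reduced_word k ((x' @ v @ y') @ [a])"
        using reduced_word_snoc_iff[OF p a(1)] by simp
      moreover have "?F' (\<alpha> b) = \<beta> (word_prod ((x' @ v @ y') @ [a]) b)" if "b \<in> {1..k}" for b
        unfolding F' word_prod_snoc o_apply comm[OF that]
        by (rule eq) (use that gen_in_range[OF a(1)] in blast)
      moreover have "gen i ` \<alpha> ` {1..k} = \<alpha> ` {1..k}"
      proof -
        have "gen i ` \<alpha> ` {1..k} = \<alpha> ` gen a ` {1..k}"
          unfolding image_image by (rule image_cong[OF refl comm])
        then show ?thesis using permutes_image[OF gen_permutes[OF a(1)]] by simp
      qed
      ultimately have "?occ [] (y @ [i]) \<alpha> \<beta> x' (y' @ [a])"
        using \<alpha> \<beta> cvx' by simp
      then show ?thesis by blast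
    next
      case False
      \<comment> \<open>At most one of the two exchanged positions belongs to the occurrence: the
        positions are adjusted and the pattern word is kept.\<close>
      have "?occ [] (y @ [i]) (gen i \<circ> \<alpha>) \<beta> x' y'"
        unfolding image_comp[symmetric]
      proof (intro conjI)
        show "gen i ` \<alpha> ` {1..k} \<subseteq> {1..n}"
          using \<alpha>(2) gen_in_range[OF i] by blast
        show "\<forall>a\<in>{1..k}. ?F' ((gen i \<circ> \<alpha>) a) = \<beta> (word_prod (x' @ v @ y') a)"
          unfolding F' using eq by simp
      qed (use \<alpha> \<beta> p cvx' strict_mono_on_gen_comp[OF \<alpha>(1) False] in \<open>blast+\<close>)
      then show ?thesis by blast
    qed
  qed
next
  case (Cons i x)
  let ?z = "x @ map (\<lambda>i. i + c) v @ y"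
  have red': "reduced_word n (i # ?z)" using Cons.prems by simp
  then have red: "reduced_word n ?z" and i: "i \<in> {1..<n}"
    using reduced_word_ConsD by (blast, simp add: reduced_word_def)
  let ?F = "word_prod ?z"
  have Fp: "?F permutes {1..n}"
    using red unfolding reduced_word_def by (blast intro: word_prod_permutes)
  obtain s t where st: "?F s = i" "?F t = Suc i"
    using permutes_surj[OF Fp] by (metis surjD)
  have lt: "s < t"
    using reduced_word_Cons_iff[OF red i st] red' by simp
  from Cons.IH[OF red] obtain \<alpha> \<beta> x' y' where
    \<alpha>: "strict_mono_on {1..k} \<alpha>" "\<alpha> ` {1..k} \<subseteq> {1..n}" and \<beta>: "strict_mono_on {1..k} \<beta>"
    and p: "reduced_word k (x' @ v @ y')"
    and eq: "\<And>a. a \<in> {1..k} \<Longrightarrow> ?F (\<alpha> a) = \<beta> (word_prod (x' @ v @ y') a)"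
    and cvx: "dominance_convex ?F (\<alpha> ` {1..k})"
    by blast
  let ?F' = "word_prod ((i # x) @ map (\<lambda>i. i + c) v @ y)"
  have F': "?F' = gen i \<circ> ?F"
    using word_prod_Cons[of i ?z] by simp
  have cvx': "dominance_convex ?F' (\<alpha> ` {1..k})"
    unfolding F' by (rule dominance_convex_gen_comp[OF cvx st lt permutes_inj[OF Fp]])
  let ?P = "word_prod (x' @ v @ y')"
  have P: "?P permutes {1..k}"
    using p unfolding reduced_word_def by (blast intro: word_prod_permutes)
  have Pin: "?P a \<in> {1..k} \<longleftrightarrow> a \<in> {1..k}" for a
    by (rule permutes_in_image[OF P])
  show ?case
  proof (cases "i \<in> \<beta> ` {1..k} \<and> Suc i \<in> \<beta> ` {1..k}")
    case True
    then obtain a where a: "a \<in> {1..<k}" "\<beta> a = i" "\<beta> (Suc a) = Suc i"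
      and comm: "\<And>b. b \<in> {1..k} \<Longrightarrow> gen i (\<beta> b) = \<beta> (gen a b)"
      using strict_mono_on_consecutive[OF \<beta>] by metis
    obtain s' t' where st': "?P s' = a" "?P t' = Suc a"
      using permutes_surj[OF P] by (metis surjD)
    then have in': "s' \<in> {1..k}" "t' \<in> {1..k}"
      using Pin[of s'] Pin[of t'] a by auto
    \<comment> \<open>Injectivity identifies the pattern positions of \<open>a\<close> and
      \<open>Suc a\<close> with the positions of \<open>i\<close> and \<open>Suc i\<close>, so that
      \<open>s < t\<close> can be read off in the pattern.\<close>
    have "\<alpha> s' = s" "\<alpha> t' = t"
      using eq[OF in'(1)] eq[OF in'(2)] st' st a inj_eq[OF permutes_inj[OF Fp]] by metis+
    then have "s' < t'"
      using lt strict_mono_on_less[OF \<alpha>(1) in'] by simp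
    then have "reduced_word k (a # x' @ v @ y')"
      using reduced_word_Cons_iff[OF p a(1) st'] by simp
    moreover have "?F' (\<alpha> b) = \<beta> (word_prod (a # x' @ v @ y') b)" if "b \<in> {1..k}" for b
      using that comm[of "?P b"] eq[OF that] Pin[of b] unfolding F' word_prod_Cons o_apply by simp
    ultimately have "?occ (i # x) y \<alpha> \<beta> (a # x') y'"
      using \<alpha> \<beta> cvx' by simp
    then show ?thesis by blast
  next
    case False
    have "\<forall>a\<in>{1..k}. ?F' (\<alpha> a) = (gen i \<circ> \<beta>) (?P a)"
      unfolding F' using eq by simp
    then have "?occ (i # x) y \<alpha> (gen i \<circ> \<beta>) x' y'"
      using \<alpha> p cvx' strict_mono_on_gen_comp[OF \<beta> False] by blast
    then show ?thesis by blast
  qed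
qed

subsection \<open>From convex occurrences to factors of reduced words\<close>

lemma down_closed_eq_interval:
  fixes D :: "nat set"
  assumes "D \<subseteq> {1..n}" "\<And>a b. b \<in> D \<Longrightarrow> 1 \<le> a \<Longrightarrow> a \<le> b \<Longrightarrow> a \<in> D"
  shows "D = {1..card D}"
proof (cases "D = {}")
  case False
  have fin: "finite D" using assms(1) finite_subset by blast
  have "D = {1..Max D}"
    using assms Max_in[OF fin False] Max_ge[OF fin] by fastforce
  then show ?thesis by (metis card_atLeastAtMost diff_Suc_1)
qed simp

text \<open>Counting the image of the initial segment \<open>{1..a}\<close> determines
  \<open>\<alpha> a\<close>.\<close>

lemma strict_mono_on_onto_interval:
  fixes \<alpha> :: "nat \<Rightarrow> nat"
  assumes mono: "strict_mono_on {1..k} \<alpha>" and img: "\<alpha> ` {1..k} = {c + 1..c + k}" and a: "a \<in> {1..k}"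
  shows "\<alpha> a = a + c"
proof -
  have less: "\<alpha> x \<le> \<alpha> y \<longleftrightarrow> x \<le> y" if "x \<in> {1..k}" "y \<in> {1..k}" for x y
    using strict_mono_on_less_eq[OF mono that] .
  have \<alpha>a: "\<alpha> a \<in> {c + 1..c + k}" using img a by blast
  have "\<alpha> ` {1..a} = {c + 1..\<alpha> a}"
  proof (intro set_eqI iffI)
    fix z assume "z \<in> \<alpha> ` {1..a}"
    then obtain x where x: "x \<in> {1..a}" "z = \<alpha> x" by blast
    then have "x \<in> {1..k}" using a by auto
    then show "z \<in> {c + 1..\<alpha> a}"
      using img x less[of x a] a by auto
  next
    fix z assume z: "z \<in> {c + 1..\<alpha> a}"
    then have "z \<in> \<alpha> ` {1..k}" unfolding img using \<alpha>a by auto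
    then obtain x where x: "x \<in> {1..k}" "z = \<alpha> x" by blast
    then show "z \<in> \<alpha> ` {1..a}" using less[of x a] a z by auto
  qed
  moreover have "inj_on \<alpha> {1..a}"
    using strict_mono_on_imp_inj_on[OF mono] a by (auto intro: inj_on_subset)
  ultimately have "card {c + 1..\<alpha> a} = a"
    using card_image[of \<alpha> "{1..a}"] by simp
  then have "\<alpha> a - c = a" by simp
  then show ?thesis using \<alpha>a unfolding atLeastAtMost_iff by arith
qed

text \<open>The sequences \<open>l\<close> and \<open>l \<circ> p\<close> are both sorted and have
  the same multiset of entries, hence coincide. Applied to labels sorted along positions and along
  values, this says that \<open>F\<close> preserves labels.\<close>

lemma mono_rearrangement_eq:
  fixes l :: "nat \<Rightarrow> nat"
  assumes p: "p permutes {1..n}"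
    and mono: "\<And>i. i \<in> {1..<n} \<Longrightarrow> l i \<le> l (Suc i)"
    and mono_p: "\<And>i. i \<in> {1..<n} \<Longrightarrow> l (p i) \<le> l (p (Suc i))"
    and a: "a \<in> {1..n}"
  shows "l (p a) = l a"
proof -
  let ?I = "[1..<Suc n]"
  have ms: "mset ?I = mset_set {1..n}"
    by (metis mset_upt atLeastLessThanSuc_atLeastAtMost)
  have sorted: "sorted (map h ?I)" if "\<And>i. i \<in> {1..<n} \<Longrightarrow> h i \<le> h (Suc i)" for h :: "nat \<Rightarrow> nat"
    unfolding sorted_iff_nth_Suc using that by (auto simp del: upt_Suc)
  have "mset (map (l \<circ> p) ?I) = image_mset l (image_mset p (mset_set {1..n}))"
    by (simp only: mset_map ms multiset.map_comp)
  also have "\<dots> = mset (map l ?I)"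
    by (simp only: mset_map ms permutes_image_mset[OF p])
  finally have "sort (map l ?I) = map (l \<circ> p) ?I"
    using sorted[of "l \<circ> p"] mono_p by (intro properties_for_sort) auto
  moreover have "sort (map l ?I) = map l ?I"
    using sorted[of l] mono by (intro properties_for_sort) auto
  ultimately have "map (l \<circ> p) ?I = map l ?I" by simp
  moreover have "a \<in> set ?I" using a by (simp del: upt_Suc)
  ultimately have "(l \<circ> p) a = l a" unfolding map_eq_conv by blast
  then show ?thesis by simp
qed

text \<open>The labels \<open>lab\<close> extend the dominance order to a total preorder in which the points
  of the occurrence (those of label \<open>m\<close>) form the only nontrivial class. As long as the positions or
  the values are not sorted by labels, some descent of \<open>F\<close> can be split off as a letter
  on the right or on the left without touching the occurrence; when both are sorted,
  \<open>F\<close> is a shift of the pattern.\<close>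

lemma mem_gen_image: "a \<in> gen i ` A \<longleftrightarrow> gen i a \<in> A"
  by (metis gen_gen imageE imageI)

lemma convex_occurrence_factor:
  fixes lab :: "nat \<Rightarrow> nat"
  assumes "F permutes {1..n}"
    and "\<And>a b. a \<in> {1..n} \<Longrightarrow> b \<in> {1..n} \<Longrightarrow> a < b \<Longrightarrow> F a < F b \<Longrightarrow> lab a \<le> lab b"
    and "\<And>a b. a \<in> {1..n} \<Longrightarrow> b \<in> {1..n} \<Longrightarrow> lab a = lab b \<Longrightarrow> a \<noteq> b \<Longrightarrow> lab a = m"
    and "strict_mono_on {1..k} \<alpha>" "\<alpha> ` {1..k} = {a \<in> {1..n}. lab a = m}"
    and "strict_mono_on {1..k} \<beta>" and "reduced_word k v"
    and "\<And>a. a \<in> {1..k} \<Longrightarrow> F (\<alpha> a) = \<beta> (word_prod v a)"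
  shows "\<exists>x y c. k + c \<le> n \<and> reduced_word n (x @ map (\<lambda>i. i + c) v @ y) \<and>
    word_prod (x @ map (\<lambda>i. i + c) v @ y) = F"
  using assms(1-6,8)
proof (induction "ell F" arbitrary: F lab \<alpha> \<beta> rule: less_induct)
  case less
  note F = less.prems(1) and mono = less.prems(2) and inj = less.prems(3)
    and \<alpha> = less.prems(4,5) and \<beta> = less.prems(6) and eq = less.prems(7)
  have Fin: "F a \<in> {1..n} \<longleftrightarrow> a \<in> {1..n}" for a
    by (rule permutes_in_image[OF F])
  have Feq: "F a = F b \<longleftrightarrow> a = b" for a b
    by (rule inj_eq[OF permutes_inj[OF F]])
  have P: "word_prod v permutes {1..k}"
    using assms(7) unfolding reduced_word_def by (blast intro: word_prod_permutes)
  \<comment> \<open>\<open>inv F i\<close> is the position of the value \<open>i\<close>; thus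
    \<open>left\<close> is a label descent along values and \<open>right\<close> one along
    positions.\<close>
  consider (right) i where "i \<in> {1..<n}" "lab (Suc i) < lab i"
    | (left) i where "i \<in> {1..<n}" "lab (inv F (Suc i)) < lab (inv F i)"
    | (sorted) "\<forall>i\<in>{1..<n}. \<not> lab (Suc i) < lab i"
        "\<forall>i\<in>{1..<n}. \<not> lab (inv F (Suc i)) < lab (inv F i)"
    by blast
  then show ?case
  proof cases
    case right
    let ?F = "F \<circ> gen i"
    have i: "i \<in> {1..n}" "Suc i \<in> {1..n}" using right(1) by auto
    have gin: "gen i a \<in> {1..n} \<longleftrightarrow> a \<in> {1..n}" for a
      by (rule gen_in_range[OF right(1)])
    \<comment> \<open>An ascent of \<open>F\<close> at \<open>i\<close> would be a dominance
      relation, and labels respect those.\<close>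
    have desc: "F (Suc i) < F i"
      using mono[OF i] right(2) Feq[of i "Suc i"] by (cases "F i < F (Suc i)") auto
    have ell: "ell F = Suc (ell ?F)"
      by (rule ell_comp_gen_descent[OF F right(1) desc])
    have "\<exists>x y c. k + c \<le> n \<and> reduced_word n (x @ map (\<lambda>i. i + c) v @ y) \<and>
      word_prod (x @ map (\<lambda>i. i + c) v @ y) = ?F"
    proof (rule less.hyps[where lab = "lab \<circ> gen i" and \<alpha> = "gen i \<circ> \<alpha>" and \<beta> = \<beta>])
      show "ell ?F < ell F" using ell by simp
      show "?F permutes {1..n}"
        by (rule permutes_compose[OF gen_permutes[OF right(1)] F])
      \<comment> \<open>The one dominance relation gained by removing the letter is between
        \<open>i\<close> and \<open>Suc i\<close>, and exchanging their labels puts these in the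
        right order.\<close>
      show "(lab \<circ> gen i) a \<le> (lab \<circ> gen i) b"
        if "a \<in> {1..n}" "b \<in> {1..n}" "a < b" "?F a < ?F b" for a b
      proof (cases "a = i \<and> b = Suc i")
        case True
        then show ?thesis using right(2) by simp
      next
        case False
        then have "gen i a < gen i b" using gen_less_iff[OF that(3)] by blast
        then show ?thesis using mono[of "gen i a" "gen i b"] that gin[of a] gin[of b]
          unfolding o_apply by blast
      qed
      show "(lab \<circ> gen i) a = m"
        if "a \<in> {1..n}" "b \<in> {1..n}" "(lab \<circ> gen i) a = (lab \<circ> gen i) b" "a \<noteq> b" for a b
      proof -
        have "gen i a \<noteq> gen i b" using that(4) by (metis gen_gen)
        then show ?thesis
          using inj[of "gen i a" "gen i b"] that gin[of a] gin[of b] unfolding o_apply by blast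
      qed
      \<comment> \<open>Points of the occurrence share the label \<open>m\<close>, whereas these two
        labels differ.\<close>
      have "\<not> (i \<in> \<alpha> ` {1..k} \<and> Suc i \<in> \<alpha> ` {1..k})"
        using right(2) \<alpha>(2) by auto
      then show "strict_mono_on {1..k} (gen i \<circ> \<alpha>)"
        by (rule strict_mono_on_gen_comp[OF \<alpha>(1)])
      have "gen i ` {a \<in> {1..n}. lab a = m} = {a \<in> {1..n}. lab (gen i a) = m}"
        using gin by (intro set_eqI) (simp only: mem_gen_image mem_Collect_eq)
      then show "(gen i \<circ> \<alpha>) ` {1..k} = {a \<in> {1..n}. (lab \<circ> gen i) a = m}"
        by (simp only: image_comp[symmetric] \<alpha>(2) o_apply)
      show "strict_mono_on {1..k} \<beta>" by (rule \<beta>)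
      show "?F ((gen i \<circ> \<alpha>) a) = \<beta> (word_prod v a)" if "a \<in> {1..k}" for a
        using eq[OF that] by simp
    qed
    then obtain x y c where c: "k + c \<le> n" and red: "reduced_word n (x @ map (\<lambda>i. i + c) v @ y)"
      and prod: "word_prod (x @ map (\<lambda>i. i + c) v @ y) = ?F"
      by blast
    have prod': "word_prod ((x @ map (\<lambda>i. i + c) v @ y) @ [i]) = F"
      unfolding word_prod_snoc prod by (rule gen_comp_gen)
    then have "reduced_word n ((x @ map (\<lambda>i. i + c) v @ y) @ [i])"
      using red right(1) ell prod unfolding reduced_word_def by simp
    then show ?thesis using c prod'
      by (intro exI[of _ x] exI[of _ "y @ [i]"] exI[of _ c]) simp
  next
    case left
    let ?F = "gen i \<circ> F"
    define s t where "s = inv F (Suc i)" and "t = inv F i"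
    have st: "F s = Suc i" "F t = i" and lab: "lab s < lab t"
      using left(2) by (simp_all add: s_def t_def permutes_inverses[OF F])
    have stn: "s \<in> {1..n}" "t \<in> {1..n}" using Fin[of s] Fin[of t] st left(1) by auto
    have lt: "s < t"
      using mono[OF stn(2,1)] lab st by (cases s t rule: linorder_cases) auto
    have ell: "ell F = Suc (ell ?F)"
      by (rule ell_gen_comp_descent[OF F left(1) st lt])
    have "\<exists>x y c. k + c \<le> n \<and> reduced_word n (x @ map (\<lambda>i. i + c) v @ y) \<and>
      word_prod (x @ map (\<lambda>i. i + c) v @ y) = ?F"
    proof (rule less.hyps[where lab = lab and \<alpha> = \<alpha> and \<beta> = "gen i \<circ> \<beta>"])
      show "ell ?F < ell F" using ell by simp
      show "?F permutes {1..n}"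
        by (rule permutes_compose[OF F gen_permutes[OF left(1)]])
      show "lab a \<le> lab b" if "a \<in> {1..n}" "b \<in> {1..n}" "a < b" "?F a < ?F b" for a b
      proof (cases "F a < F b")
        case True
        then show ?thesis using mono that by blast
      next
        case False
        then have lt': "F b < F a" using Feq[of a b] that(3) by (metis less_irrefl linorder_neqE_nat)
        then have "F b = i \<and> F a = Suc i"
          using gen_less_iff[OF lt', of i] that(4) by auto
        then have "b = t" "a = s" using st Feq by metis+
        then show ?thesis using lab by simp
      qed
      show "lab a = m" if "a \<in> {1..n}" "b \<in> {1..n}" "lab a = lab b" "a \<noteq> b" for a b
        by (rule inj[OF that])
      \<comment> \<open>The map \<open>word_prod v\<close> is onto \<open>{1..k}\<close>, so every
        value of \<open>\<beta>\<close> is the value of a point of the occurrence.\<close>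
      have in_\<beta>: "lab r = m" if r: "F r \<in> \<beta> ` {1..k}" for r
      proof -
        obtain b where b: "b \<in> {1..k}" "F r = \<beta> b" using r by blast
        then obtain a where a: "a \<in> {1..k}" "word_prod v a = b"
          using permutes_image[OF P] by (metis imageE)
        then have "r = \<alpha> a" using eq[OF a(1)] b(2) Feq by metis
        then show ?thesis using \<alpha>(2) a(1) by blast
      qed
      have "\<not> (i \<in> \<beta> ` {1..k} \<and> Suc i \<in> \<beta> ` {1..k})"
        using in_\<beta>[of s] in_\<beta>[of t] st lab by auto
      then show "strict_mono_on {1..k} (gen i \<circ> \<beta>)"
        by (rule strict_mono_on_gen_comp[OF \<beta>])
      show "?F (\<alpha> a) = (gen i \<circ> \<beta>) (word_prod v a)" if "a \<in> {1..k}" for a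
        using eq[OF that] by simp
    qed (rule \<alpha>)+
    then obtain x y c where c: "k + c \<le> n" and red: "reduced_word n (x @ map (\<lambda>i. i + c) v @ y)"
      and prod: "word_prod (x @ map (\<lambda>i. i + c) v @ y) = ?F"
      by blast
    have prod': "word_prod (i # x @ map (\<lambda>i. i + c) v @ y) = F"
      unfolding word_prod_Cons prod by (rule gen_comp_gen)
    then have "reduced_word n (i # x @ map (\<lambda>i. i + c) v @ y)"
      using red left(1) ell prod unfolding reduced_word_def by simp
    then show ?thesis using c prod'
      by (intro exI[of _ "i # x"] exI[of _ y] exI[of _ c]) simp
  next
    case sorted
    have sorted: "lab i \<le> lab (Suc i)" "lab (inv F i) \<le> lab (inv F (Suc i))" if "i \<in> {1..<n}" for i
      using sorted that by (simp_all add: not_less)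
    \<comment> \<open>Labels outside the block are pairwise distinct, so preserving them forces
      \<open>F\<close> to fix every point there.\<close>
    have labF: "lab (F a) = lab a" if "a \<in> {1..n}" for a
      using mono_rearrangement_eq[OF permutes_inv[OF F] sorted, of "F a"] Fin that
      by (simp add: permutes_inverses[OF F])
    have lab_mono: "lab a \<le> lab b" if "1 \<le> a" "a \<le> b" "b \<le> n" for a b
      using that(2,3)
    proof (induction b rule: dec_induct)
      case (step b)
      then show ?case using sorted(1)[of b] that(1) by simp
    qed simp
    \<comment> \<open>Labels increase weakly along positions, so the positions with label below
      \<open>m\<close>, and those with label at most \<open>m\<close>, are initial segments. Their
      sizes \<open>c\<close> and \<open>c + k\<close> locate the block, and \<open>c\<close> is the
      shift.\<close>
    define D where "D = {a \<in> {1..n}. lab a < m}"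
    define I where "I = {a \<in> {1..n}. lab a = m}"
    define c where "c = card D"
    have D: "D = {1..c}"
      unfolding c_def
    proof (rule down_closed_eq_interval)
      show "D \<subseteq> {1..n}" by (auto simp: D_def)
      show "a \<in> D" if "b \<in> D" "1 \<le> a" "a \<le> b" for a b
        using that lab_mono[of a b] by (auto simp: D_def)
    qed
    have "card I = k"
      using card_image[OF strict_mono_on_imp_inj_on[OF \<alpha>(1)]] \<alpha>(2) by (simp add: I_def)
    moreover have "D \<inter> I = {}" "finite D" "finite I" by (auto simp: D_def I_def)
    ultimately have card: "card (D \<union> I) = c + k"
      by (simp add: card_Un_disjoint c_def)
    have "D \<union> I = {1..card (D \<union> I)}"
    proof (rule down_closed_eq_interval)
      show sub: "D \<union> I \<subseteq> {1..n}" by (auto simp: D_def I_def)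
      show "a \<in> D \<union> I" if "b \<in> D \<union> I" "1 \<le> a" "a \<le> b" for a b
        using that lab_mono[of a b] sub by (auto simp: D_def I_def)
    qed
    then have DI: "D \<union> I = {1..c + k}" by (simp only: card)
    have "I = (D \<union> I) - D" using \<open>D \<inter> I = {}\<close> by blast
    also have "\<dots> = {1..c + k} - {1..c}" unfolding DI by (rule arg_cong[OF D])
    also have "\<dots> = {c + 1..c + k}"
      by (rule set_eqI) (unfold Diff_iff atLeastAtMost_iff, arith)
    finally have I: "I = {c + 1..c + k}" .
    have "D \<union> I \<subseteq> {1..n}" by (auto simp: D_def I_def)
    then have cn: "k + c \<le> n"
      using card_mono[of "{1..n}" "D \<union> I"] card by simp
    have FI: "F ` I = I"
    proof (rule card_subset_eq)
      show "F ` I \<subseteq> I" using labF Fin by (auto simp: I_def simp del: atLeastAtMost_iff)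
      show "card (F ` I) = card I"
        by (rule card_image) (metis Feq inj_onI)
    qed (simp add: I_def)
    have \<alpha>_img: "\<alpha> ` {1..k} = {c + 1..c + k}" using \<alpha>(2) I by (simp add: I_def)
    have "\<beta> ` {1..k} = \<beta> ` word_prod v ` {1..k}"
      by (simp only: permutes_image[OF P])
    also have "\<dots> = F ` \<alpha> ` {1..k}"
      unfolding image_image by (rule image_cong[OF refl]) (simp only: eq)
    finally have \<beta>_img: "\<beta> ` {1..k} = {c + 1..c + k}"
      using \<alpha>_img FI I by simp
    have F_eq: "word_prod (map (\<lambda>i. i + c) v) a = F a" for a
    proof -
      consider (block) b where "b \<in> {1..k}" "a = b + c"
        | (fixed) "F a = a" "a \<notin> {c + 1..c + k}"
      proof (cases "a \<in> I")
        case True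
        then have "a - c \<in> {1..k}" "a = (a - c) + c" using I by auto
        then show ?thesis using that(1) by blast
      next
        case False
        have "F a = a"
        proof (cases "a \<in> {1..n}")
          case True
          then have "lab a \<noteq> m" using False by (simp add: I_def)
          then show ?thesis using inj[of "F a" a] labF[OF True] Fin True by metis
        qed (rule permutes_not_in[OF F])
        then show ?thesis using False I that(2) by blast
      qed
      then show ?thesis
      proof cases
        case block
        have Pb: "word_prod v b \<in> {1..k}" using permutes_in_image[OF P] block(1) by blast
        have "F a = F (\<alpha> b)"
          using strict_mono_on_onto_interval[OF \<alpha>(1) \<alpha>_img block(1)] block(2) by simp
        also have "\<dots> = word_prod v b + c"
          using eq[OF block(1)] strict_mono_on_onto_interval[OF \<beta> \<beta>_img Pb] by simp
        finally show ?thesis using block(2) by (simp add: word_prod_shift)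
      next
        case fixed
        show ?thesis
        proof (cases "a \<le> c")
          case True
          have "0 \<notin> set v" using assms(7) by (auto simp: reduced_word_def)
          then show ?thesis using word_prod_shift_below[OF _ True] fixed(1) by simp
        next
          case False
          then have "a = (a - c) + c" "a - c \<notin> {1..k}" using fixed(2) by auto
          then show ?thesis
            using word_prod_shift[of c v "a - c"] permutes_not_in[OF P] fixed(1) by simp
        qed
      qed
    qed
    have "reduced_word n ([] @ map (\<lambda>i. i + c) v @ [])"
      using reduced_word_shift[OF assms(7) cn] by simp
    moreover have "word_prod ([] @ map (\<lambda>i. i + c) v @ []) = F"
      using F_eq by (simp add: fun_eq_iff)
    ultimately show ?thesis using cn by blast
  qed
qed

subsection \<open>Heap containment as containment of a factor\<close>

text \<open>The bound on \<open>c\<close> makes room for all generators of the rank of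
  \<open>h\<close>, including those that do not occur in \<open>v\<close>.\<close>

definition factor_contains :: "nat list \<Rightarrow> nat list \<Rightarrow> bool" where
  "factor_contains w h \<longleftrightarrow>
     (\<exists>x v y c. length h + c \<le> length w \<and> reduced_expression h v \<and>
        reduced_expression w (x @ map (\<lambda>i. i + c) v @ y))"

lemma word_prod_comp_gen:
  assumes "\<And>a. a \<in> set A \<Longrightarrow> gen a \<circ> gen m = gen m \<circ> gen a"
  shows "word_prod A \<circ> gen m = gen m \<circ> word_prod A"
  using assms
proof (induction A)
  case (Cons a A)
  have IH: "word_prod A \<circ> gen m = gen m \<circ> word_prod A"
    by (rule Cons.IH, rule Cons.prems) simp
  have a: "gen a \<circ> gen m = gen m \<circ> gen a"
    by (rule Cons.prems) simp
  have "word_prod (a # A) \<circ> gen m = gen a \<circ> (word_prod A \<circ> gen m)"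
    by (simp only: word_prod_Cons comp_assoc)
  also have "\<dots> = (gen a \<circ> gen m) \<circ> word_prod A"
    by (simp only: IH comp_assoc)
  also have "\<dots> = gen m \<circ> word_prod (a # A)"
    by (simp only: a word_prod_Cons comp_assoc)
  finally show ?case .
qed (simp add: word_prod_Nil)

text \<open>The first element \<open>m\<close> of \<open>M\<close> is preceded in \<open>L\<close>
  only by elements unrelated to it. Their letters commute with that of \<open>m\<close>, so
  \<open>m\<close> can be pulled to the front of \<open>L\<close> and removed.\<close>

lemma word_prod_linear_extension:
  assumes "distinct L" "distinct M" "set L = set M"
    and "sorted_wrt (\<lambda>a b. (b, a) \<notin> R) L" "sorted_wrt (\<lambda>a b. (b, a) \<notin> R) M"
    and "\<And>a b. a \<in> set L \<Longrightarrow> b \<in> set L \<Longrightarrow> a \<noteq> b \<Longrightarrow> gen (l a) \<circ> gen (l b) \<noteq> gen (l b) \<circ> gen (l a) \<Longrightarrow>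
      (a, b) \<in> R \<or> (b, a) \<in> R"
  shows "word_prod (map l L) = word_prod (map l M)"
  using assms
proof (induction M arbitrary: L)
  case (Cons m M)
  then obtain A B where L: "L = A @ m # B" by (metis list.set_intros(1) split_list)
  have sub: "set (A @ B) = set M" using Cons.prems(1-3) unfolding L by auto
  have IH: "word_prod (map l (A @ B)) = word_prod (map l M)"
  proof (rule Cons.IH)
    show "(a, b) \<in> R \<or> (b, a) \<in> R"
      if "a \<in> set (A @ B)" "b \<in> set (A @ B)" "a \<noteq> b" "gen (l a) \<circ> gen (l b) \<noteq> gen (l b) \<circ> gen (l a)" for a b
      by (rule Cons.prems(6)[OF _ _ that(3,4)]) (use that(1,2) in \<open>auto simp: L\<close>)
  qed (use Cons.prems(1-5) sub in \<open>auto simp: L sorted_wrt_append\<close>)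
  have "gen a \<circ> gen (l m) = gen (l m) \<circ> gen a" if a: "a \<in> set (map l A)" for a
  proof (rule ccontr)
    assume neq: "gen a \<circ> gen (l m) \<noteq> gen (l m) \<circ> gen a"
    obtain b where b: "b \<in> set A" "a = l b" using a by auto
    have "(m, b) \<notin> R" using Cons.prems(4) b unfolding L by (auto simp: sorted_wrt_append)
    moreover have "(b, m) \<notin> R" using Cons.prems(5) b sub by auto
    moreover have "b \<noteq> m" using Cons.prems(1) b unfolding L by auto
    moreover have "b \<in> set L" "m \<in> set L" using b(1) unfolding L by auto
    ultimately show False
      using Cons.prems(6)[of b m] neq unfolding b(2) by blast
  qed
  then have comm: "word_prod (map l A) \<circ> gen (l m) = gen (l m) \<circ> word_prod (map l A)"
    by (rule word_prod_comp_gen)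
  have "word_prod (map l L) = (word_prod (map l A) \<circ> gen (l m)) \<circ> word_prod (map l B)"
    unfolding L by (simp only: map_append list.map word_prod_append word_prod_Cons comp_assoc)
  also have "\<dots> = gen (l m) \<circ> word_prod (map l (A @ B))"
    by (simp only: comm map_append word_prod_append comp_assoc)
  also have "\<dots> = word_prod (map l (m # M))"
    by (simp only: IH list.map word_prod_Cons)
  finally show ?case .
qed simp

lemma heap_step_less: "(a, b) \<in> heap_step u \<Longrightarrow> a < b"
  by (simp add: heap_step_def)

lemma rtrancl_heap_step_le: "(a, b) \<in> (heap_step u)\<^sup>* \<Longrightarrow> a \<le> b"
  by (induction rule: rtrancl_induct) (auto dest: heap_step_less)

text \<open>The positions of \<open>u\<close> are rearranged into a linear extension of its heap in
  which the subheap is contiguous and ordered as in \<open>v\<close>; this changes neither the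
  product nor the letters.\<close>

lemma convex_labeled_subheap_imp_factor:
  assumes "convex_labeled_subheap v u"
  obtains x y where "word_prod (x @ v @ y) = word_prod u" "length (x @ v @ y) = length u"
    "set (x @ v @ y) = set u"
proof -
  obtain g where inj: "inj_on g {..<length v}" and sub: "g ` {..<length v} \<subseteq> {..<length u}"
    and lab: "\<forall>i<length v. u ! g i = v ! i"
    and iso: "\<forall>i<length v. \<forall>j<length v. (i, j) \<in> heap_le v \<longleftrightarrow> (g i, g j) \<in> heap_le u"
    and cvx: "\<forall>x\<in>g ` {..<length v}. \<forall>z\<in>g ` {..<length v}. \<forall>y.
      (x, y) \<in> heap_le u \<and> (y, z) \<in> heap_le u \<longrightarrow> y \<in> g ` {..<length v}"
    using assms unfolding convex_labeled_subheap_def by (elim exE conjE) (rule that; assumption)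
  define G where "G = g ` {..<length v}"
  \<comment> \<open>Elements below the subheap must precede it; all remaining ones can follow
    it.\<close>
  define below where "below p \<longleftrightarrow> (\<exists>z\<in>G. (p, z) \<in> heap_le u)" for p
  define X where "X = filter (\<lambda>p. p \<notin> G \<and> below p) [0..<length u]"
  define Y where "Y = filter (\<lambda>p. p \<notin> G \<and> \<not> below p) [0..<length u]"
  define M where "M = X @ map g [0..<length v] @ Y"
  let ?L = "[0..<length u]"
  have setG: "set (map g [0..<length v]) = G"
    by (auto simp: G_def)
  have le: "(a, b) \<in> heap_le u" if "(a, b) \<in> heap_step u" for a b
    using that by (auto simp: heap_le_def heap_step_def)
  have trans: "(a, c) \<in> heap_le u" if "(a, b) \<in> heap_le u" "(b, c) \<in> heap_le u" for a b c
    using that by (auto simp: heap_le_def)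
  have distinct: "distinct M"
    using inj setG by (auto simp: M_def X_def Y_def distinct_map G_def lessThan_atLeast0)
  have set: "set ?L = set M"
    using sub setG by (auto simp: M_def X_def Y_def G_def)
  have "word_prod (map ((!) u) ?L) = word_prod (map ((!) u) M)"
  proof (rule word_prod_linear_extension[where R = "heap_step u"])
    have incr: "sorted_wrt (\<lambda>a b. (b, a) \<notin> heap_step u) (filter Q ?L)" for Q
      by (rule sorted_wrt_filter, rule sorted_wrt_mono_rel[OF _ sorted_wrt_upt]) (auto dest: heap_step_less)
    show "sorted_wrt (\<lambda>a b. (b, a) \<notin> heap_step u) ?L"
      using incr[of "\<lambda>_. True"] by simp
    \<comment> \<open>Inside the subheap the heap order of \<open>u\<close> is that of
      \<open>v\<close>, for which the given order of letters is a linear extension.\<close>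
    have mid: "sorted_wrt (\<lambda>a b. (b, a) \<notin> heap_step u) (map g [0..<length v])"
      unfolding sorted_wrt_map
    proof (rule sorted_wrt_mono_rel[OF _ sorted_wrt_upt])
      fix i j assume "i \<in> set [0..<length v]" "j \<in> set [0..<length v]" "i < j"
      then have "(j, i) \<notin> heap_le v" "i < length v" "j < length v"
        by (auto simp: heap_le_def dest: rtrancl_heap_step_le)
      then show "(g j, g i) \<notin> heap_step u" using iso le by blast
    qed
    have X: "p \<notin> G" "below p" if "p \<in> set X" for p
      using that by (simp_all add: X_def)
    have Y: "r \<notin> G" "\<not> below r" if "r \<in> set Y" for r
      using that by (simp_all add: Y_def)
    \<comment> \<open>This is where convexity enters: \<open>p\<close> would lie above
      \<open>z\<close> and below some element of the subheap without belonging to it.\<close>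
    have XG: "(z, p) \<notin> heap_step u" if "p \<in> set X" "z \<in> G" for p z
      using X[OF that(1)] that(2) cvx le unfolding below_def G_def by blast
    have XY: "(r, p) \<notin> heap_step u" if p: "p \<in> set X" and r: "r \<in> set Y" for p r
    proof
      assume "(r, p) \<in> heap_step u"
      moreover obtain z where "z \<in> G" "(p, z) \<in> heap_le u"
        using X(2)[OF p] unfolding below_def by blast
      ultimately have "below r" unfolding below_def using le trans by metis
      then show False using Y(2)[OF r] by blast
    qed
    have GY: "(r, z) \<notin> heap_step u" if "z \<in> G" "r \<in> set Y" for z r
      using Y(2)[OF that(2)] that(1) le unfolding below_def by blast
    show "sorted_wrt (\<lambda>a b. (b, a) \<notin> heap_step u) M"
      unfolding M_def sorted_wrt_append setG set_append
    proof (intro conjI ballI)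
      show "sorted_wrt (\<lambda>a b. (b, a) \<notin> heap_step u) X" "sorted_wrt (\<lambda>a b. (b, a) \<notin> heap_step u) Y"
        unfolding X_def Y_def by (rule incr)+
    qed (use mid XG XY GY in blast)+
    show "(a, b) \<in> heap_step u \<or> (b, a) \<in> heap_step u"
      if "a \<in> set ?L" "b \<in> set ?L" "a \<noteq> b" "gen (u ! a) \<circ> gen (u ! b) \<noteq> gen (u ! b) \<circ> gen (u ! a)" for a b
    proof -
      have "a < b \<or> b < a" using that(3) by arith
      then show ?thesis using that(1,2,4) that(4)[symmetric]
        unfolding heap_step_def by simp
    qed
  qed (use distinct set in auto)
  then have prod: "word_prod (map ((!) u) M) = word_prod u"
    by (simp only: map_nth)
  have "map ((!) u) (map g [0..<length v]) = v"
    using lab by (intro nth_equalityI) auto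
  then have map: "map ((!) u) M = map ((!) u) X @ v @ map ((!) u) Y"
    by (simp only: M_def map_append)
  have "length M = length u"
    using distinct_card[OF distinct] unfolding set[symmetric] by simp
  moreover have "set (map ((!) u) M) = set u"
    by (simp only: set_map set[symmetric]) (simp only: set_map[symmetric] map_nth)
  ultimately show ?thesis
    using that[of "map ((!) u) X" "map ((!) u) Y"] prod unfolding map[symmetric] by simp
qed

text \<open>Heap chains increase in position, so a chain between two positions of a factor never
  leaves it. This yields both the agreement of the two orders and convexity.\<close>

lemma factor_imp_convex_labeled_subheap: "convex_labeled_subheap v (x @ v @ y)"
proof -
  let ?u = "x @ v @ y" and ?n = "length x"
  let ?g = "\<lambda>i. i + ?n"
  have nth: "?u ! (i + ?n) = v ! i" if "i < length v" for i
    using that by (simp add: nth_append)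
  have up: "(i + ?n, j + ?n) \<in> (heap_step ?u)\<^sup>*" if "(i, j) \<in> (heap_step v)\<^sup>*" for i j
    using that
  proof (induction rule: rtrancl_induct)
    case (step a b)
    then have "(a + ?n, b + ?n) \<in> heap_step ?u"
      using nth[of a] nth[of b] by (auto simp: heap_step_def)
    then show ?case using step.IH by (rule rtrancl_into_rtrancl[rotated])
  qed simp
  have down: "(a - ?n, b - ?n) \<in> (heap_step v)\<^sup>*"
    if "(a, b) \<in> (heap_step ?u)\<^sup>*" "?n \<le> a" "b < ?n + length v" for a b
    using that
  proof (induction rule: converse_rtrancl_induct)
    case (step a r)
    have r: "a < r" "r \<le> b"
      using heap_step_less[OF step.hyps(1)] rtrancl_heap_step_le[OF step.hyps(2)] by auto
    have "(a - ?n, r - ?n) \<in> heap_step v"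
      using step.hyps(1) step.prems r nth[of "a - ?n"] nth[of "r - ?n"] by (auto simp: heap_step_def)
    then show ?case
      using step.IH step.prems r by (simp add: converse_rtrancl_into_rtrancl)
  qed simp
  have img: "?g ` {..<length v} = {?n..<?n + length v}"
    by (simp add: lessThan_atLeast0 image_add_atLeastLessThan' add.commute)
  show ?thesis
    unfolding convex_labeled_subheap_def
  proof (intro exI[of _ ?g] conjI)
    show "\<forall>i<length v. \<forall>j<length v. (i, j) \<in> heap_le v \<longleftrightarrow> (?g i, ?g j) \<in> heap_le ?u"
    proof (intro allI impI)
      fix i j assume "i < length v" "j < length v"
      then show "(i, j) \<in> heap_le v \<longleftrightarrow> (?g i, ?g j) \<in> heap_le ?u"
        using up[of i j] down[of "i + ?n" "j + ?n"] by (auto simp: heap_le_def)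
    qed
    show "\<forall>a\<in>?g ` {..<length v}. \<forall>b\<in>?g ` {..<length v}. \<forall>r.
      (a, r) \<in> heap_le ?u \<and> (r, b) \<in> heap_le ?u \<longrightarrow> r \<in> ?g ` {..<length v}"
      unfolding img by (auto simp: heap_le_def dest!: rtrancl_heap_step_le)
    show "?g ` {..<length v} \<subseteq> {..<length ?u}" unfolding img by auto
    show "\<forall>i<length v. ?u ! ?g i = v ! i" using nth by blast
  qed simp
qed

section \<open>Orientation preserving Coxeter embeddings are shifts of indices\<close>

text \<open>Otherwise the two generators commute and the cube of their product is the product
  itself, which sends \<open>a\<close> to \<open>Suc a\<close>.\<close>

lemma gen_comp_gen_cube_imp_consecutive:
  assumes "(gen a \<circ> gen b) ^^ 3 = id" "a < b"
  shows "b = Suc a"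
proof (rule ccontr)
  assume "b \<noteq> Suc a"
  then have "((gen a \<circ> gen b) ^^ 3) a = Suc a"
    using assms(2) by (simp add: numeral_3_eq_3 gen_apply)
  then show False using assms(1) by simp
qed

lemma gen_comp_gen_Suc_cube: "(gen a \<circ> gen (Suc a)) ^^ 3 = id"
  by (rule ext) (simp add: numeral_3_eq_3 gen_apply)

text \<open>The relation with exponent 3 sends consecutive generators to neighbours, and
  monotonicity selects the upper neighbour.\<close>

lemma coxeter_embedding_shift:
  assumes f: "coxeter_embedding k n f" and n: "1 \<le> n"
  obtains c where "k + c \<le> n" "\<And>i. i \<in> {1..<k} \<Longrightarrow> f i = i + c"
proof (cases "2 \<le> k")
  case False
  \<comment> \<open>With \<open>k\<close> at most 1 there is no generator to map; only
    \<open>k \<le> n\<close> has to hold, and it does because \<open>1 \<le> n\<close>.\<close>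
  then show ?thesis using that[of 0] n by auto
next
  case True
  have im: "\<And>i. i \<in> {1..<k} \<Longrightarrow> f i \<in> {1..<n}"
    and cube: "\<And>i j. i \<in> {1..<k} \<Longrightarrow> j \<in> {1..<k} \<Longrightarrow>
      (gen i \<circ> gen j) ^^ 3 = id \<longleftrightarrow> (gen (f i) \<circ> gen (f j)) ^^ 3 = id"
    and mono: "\<And>i j. i \<in> {1..<k} \<Longrightarrow> j \<in> {1..<k} \<Longrightarrow> i < j \<Longrightarrow> f i < f j"
    using f unfolding coxeter_embedding_def by blast+
  have Suc: "f (Suc i) = Suc (f i)" if "1 \<le> i" "Suc i < k" for i
    using cube[of i "Suc i"] mono[of i "Suc i"] gen_comp_gen_Suc_cube[of i] that
    by (intro gen_comp_gen_cube_imp_consecutive) auto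
  \<comment> \<open>Indices start at 1, so the offset is \<open>f 1 - 1\<close>; the subtraction is
    exact since \<open>f 1\<close> is a generator index.\<close>
  have shift: "f i = i + (f 1 - 1)" if "1 \<le> i" "i < k" for i
    using that
  proof (induction i rule: dec_induct)
    case base
    then show ?case using im[of 1] by simp
  next
    case (step i)
    then show ?case using Suc[of i] by simp
  qed
  show ?thesis
  proof (rule that[of "f 1 - 1"])
    have "f (k - 1) < n" using im[of "k - 1"] True by simp
    moreover have "f (k - 1) = (k - 1) + (f 1 - 1)" by (rule shift) (use True in auto)
    ultimately show "k + (f 1 - 1) \<le> n" using True by linarith
    show "f i = i + (f 1 - 1)" if "i \<in> {1..<k}" for i
      by (rule shift) (use that in auto)
  qed
qed

text \<open>A shifted word acts above \<open>c\<close> as the original one and fixes all points up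
  to \<open>c\<close>. Thus equalities between words transfer both ways, which serves the Coxeter
  relations and the exchange of reduced words inside a factor.\<close>

lemma word_prod_shift_inject:
  assumes "0 \<notin> set u" "0 \<notin> set v"
  shows "word_prod (map (\<lambda>i. i + c) u) = word_prod (map (\<lambda>i. i + c) v) \<longleftrightarrow> word_prod u = word_prod v"
proof
  assume *: "word_prod (map (\<lambda>i. i + c) u) = word_prod (map (\<lambda>i. i + c) v)"
  show "word_prod u = word_prod v"
  proof
    fix a show "word_prod u a = word_prod v a"
      using word_prod_shift[of c u a] word_prod_shift[of c v a] * by simp
  qed
next
  assume *: "word_prod u = word_prod v"
  show "word_prod (map (\<lambda>i. i + c) u) = word_prod (map (\<lambda>i. i + c) v)"
  proof
    fix a show "word_prod (map (\<lambda>i. i + c) u) a = word_prod (map (\<lambda>i. i + c) v) a"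
      using word_prod_shift[of c u "a - c"] word_prod_shift_below[OF assms(1), of a c]
        word_prod_shift[of c v "a - c"] word_prod_shift_below[OF assms(2), of a c] *
      by (cases "a \<le> c") auto
  qed
qed

text \<open>A power of a product of two generators is the product of a repeated word, so each
  relation is an equality with the empty word and survives shifting.\<close>

lemma shift_coxeter_embedding:
  assumes "k + c \<le> n"
  shows "coxeter_embedding k n (\<lambda>i. i + c)"
proof -
  have "(gen i \<circ> gen j) ^^ m = word_prod (concat (replicate m [i, j]))" for i j m
    by (induction m) (simp_all add: word_prod_Nil word_prod_Cons comp_assoc fun_eq_iff)
  moreover have "concat (replicate m [i + c, j + c]) = map (\<lambda>i. i + c) (concat (replicate m [i, j]))"
    for i j m by (induction m) auto
  moreover have "0 \<notin> set (concat (replicate m [i, j]))" if "i \<in> {1..<k}" "j \<in> {1..<k}" for i j m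
    using that by auto
  ultimately have "(gen i \<circ> gen j) ^^ m = id \<longleftrightarrow> (gen (i + c) \<circ> gen (j + c)) ^^ m = id"
    if "i \<in> {1..<k}" "j \<in> {1..<k}" for i j m
    using word_prod_shift_inject[of "[]" "concat (replicate m [i, j])" c] that
    by (metis empty_iff list.map(1) list.set(1) word_prod_Nil)
  then show ?thesis
    using assms unfolding coxeter_embedding_def by (auto simp: inj_on_def)
qed

lemma heap_contains_iff_factor_contains:
  assumes "1 \<le> length w"
  shows "heap_contains w h \<longleftrightarrow> factor_contains w h"
proof
  assume "heap_contains w h"
  then obtain u v f where u: "reduced_expression w u" and v: "reduced_expression h v"
    and f: "coxeter_embedding (length h) (length w) f" and sub: "convex_labeled_subheap (map f v) u"
    unfolding heap_contains_def by blast
  obtain c where c: "length h + c \<le> length w" "\<And>i. i \<in> {1..<length h} \<Longrightarrow> f i = i + c"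
    using coxeter_embedding_shift[OF f assms] by blast
  have fv: "map f v = map (\<lambda>i. i + c) v"
    using v c(2) by (auto simp: reduced_expression_def expression_def)
  obtain x y where xy: "word_prod (x @ map f v @ y) = word_prod u"
    "length (x @ map f v @ y) = length u" "set (x @ map f v @ y) = set u"
    using convex_labeled_subheap_imp_factor[OF sub] by metis
  \<comment> \<open>Product, length and letters agree with those of \<open>u\<close>, which is all
    that being a reduced expression depends on.\<close>
  have "reduced_expression w (x @ map f v @ y)"
    using u unfolding reduced_expression_def expression_def xy by blast
  then show "factor_contains w h"
    unfolding factor_contains_def fv using c v by blast
next
  assume "factor_contains w h"
  then show "heap_contains w h"
    unfolding factor_contains_def heap_contains_def
    using shift_coxeter_embedding factor_imp_convex_labeled_subheap by blast
qed

subsection \<open>Permutations in 1-line notation\<close>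

lemma Sym_iff: "w \<in> Sym n \<longleftrightarrow> distinct w \<and> set w = {1..n}"
  by (auto simp: Sym_def permutations_of_set_def)

lemma length_Sym: "w \<in> Sym n \<Longrightarrow> length w = n"
  unfolding Sym_iff by (metis card_atLeastAtMost diff_Suc_1 distinct_card)

lemma perms_iff: "w \<in> perms \<longleftrightarrow> 1 \<le> length w \<and> w \<in> Sym (length w)"
proof
  assume "w \<in> perms"
  then obtain n where "1 \<le> n" "w \<in> Sym n" unfolding perms_def by auto
  then show "1 \<le> length w \<and> w \<in> Sym (length w)" using length_Sym[of w n] by simp
qed (auto simp: perms_def)

lemma nth_eq_iff_perms: "w \<in> perms \<Longrightarrow> i < length w \<Longrightarrow> j < length w \<Longrightarrow> w ! i = w ! j \<longleftrightarrow> i = j"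
  by (simp add: perms_iff Sym_iff nth_eq_iff_index_eq)

lemma perm_fun_Suc: "i < length w \<Longrightarrow> perm_fun w (Suc i) = w ! i"
  by (simp add: perm_fun_def)

lemma perm_fun_permutes:
  assumes "w \<in> perms"
  shows "perm_fun w permutes {1..length w}"
proof (rule bij_imp_permutes)
  have dist: "distinct w" and set: "set w = {1..length w}"
    using assms by (simp_all add: perms_iff Sym_iff)
  have "perm_fun w ` {1..length w} = perm_fun w ` Suc ` {..<length w}"
    by (simp only: image_Suc_lessThan)
  also have "\<dots> = (!) w ` {..<length w}"
    unfolding image_image by (rule image_cong) (simp_all add: perm_fun_Suc)
  also have "\<dots> = {1..length w}"
    unfolding set[symmetric] set_conv_nth by auto
  finally have img: "perm_fun w ` {1..length w} = {1..length w}" .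
  then show "bij_betw (perm_fun w) {1..length w} {1..length w}"
    by (simp add: bij_betw_def eq_card_imp_inj_on)
qed (simp only: perm_fun_def if_False)

lemma ex_perm_of_permutes:
  assumes "f permutes {1..k}" "1 \<le> k"
  obtains p where "p \<in> Sym k" "p \<in> perms" "length p = k" "perm_fun p = f"
proof -
  define p where "p = map f [1..<Suc k]"
  have "set p = f ` {1..k}" by (simp only: p_def set_map set_upt atLeastLessThanSuc_atLeastAtMost)
  moreover have "distinct p"
    unfolding p_def distinct_map using permutes_inj_on[OF assms(1)] by simp
  ultimately have p: "p \<in> Sym k"
    unfolding Sym_iff using permutes_image[OF assms(1)] by simp
  then have len: "length p = k" by (rule length_Sym)
  have "perm_fun p a = f a" for a
  proof (cases "a \<in> {1..k}")
    case True
    then have "[1..<Suc k] ! (a - 1) = a" by (subst nth_upt) auto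
    moreover have "p ! (a - 1) = f ([1..<Suc k] ! (a - 1))"
      unfolding p_def by (rule nth_map) (use True in auto)
    ultimately show ?thesis using True len by (simp only: perm_fun_def if_True)
  next
    case False
    then show ?thesis using permutes_not_in[OF assms(1) False] False
      by (simp only: perm_fun_def len if_False)
  qed
  then show ?thesis using that[of p] p len assms(2) by (auto simp: perms_iff fun_eq_iff)
qed

text \<open>The empty pattern occurs everywhere: with positions as labels and block label
  \<open>Suc n\<close>, the block is empty and the whole permutation is sorted away.\<close>

lemma ex_reduced_word:
  assumes "f permutes {1..n}"
  obtains u where "reduced_word n u" "word_prod u = f"
proof -
  have "\<exists>x y c. 0 + c \<le> n \<and> reduced_word n (x @ map (\<lambda>i. i + c) [] @ y) \<and>
    word_prod (x @ map (\<lambda>i. i + c) [] @ y) = f"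
  proof (rule convex_occurrence_factor[where lab = "\<lambda>a. a" and m = "Suc n" and \<alpha> = id and \<beta> = id])
    show "reduced_word 0 []" by (simp add: reduced_word_def word_prod_Nil)
  qed (use assms in \<open>auto simp: strict_mono_on_def\<close>)
  then show ?thesis using that by auto
qed

text \<open>Some expression has exactly \<open>ell (perm_fun w)\<close> letters and none has fewer,
  so minimal length and number of inversions coincide.\<close>

lemma reduced_expression_iff:
  assumes "w \<in> perms"
  shows "reduced_expression w u \<longleftrightarrow> reduced_word (length w) u \<and> word_prod u = perm_fun w"
proof -
  obtain u' where u': "reduced_word (length w) u'" "word_prod u' = perm_fun w"
    using ex_reduced_word[OF perm_fun_permutes[OF assms]] by blast
  then have "expression w u'" and len: "length u' = ell (perm_fun w)"
    by (auto simp: expression_def reduced_word_def)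
  moreover have "ell (perm_fun w) \<le> length v" if "expression w v" for v
    using that ell_word_prod_le unfolding expression_def by metis
  ultimately show ?thesis
    unfolding reduced_expression_def reduced_word_def expression_def by (metis order_antisym)
qed

subsection \<open>Occurrences of patterns\<close>

text \<open>Positions are counted from 0 here, whereas \<open>perm_fun\<close> takes arguments from
  1. The order condition covers all pairs of indices, so that it composes and transfers without case
  distinctions.\<close>

definition occurrence :: "nat list \<Rightarrow> nat list \<Rightarrow> (nat \<Rightarrow> nat) \<Rightarrow> bool" where
  "occurrence w p i \<longleftrightarrow>
     strict_mono_on {..<length p} i \<and> i ` {..<length p} \<subseteq> {..<length w} \<and>
     (\<forall>a<length p. \<forall>b<length p. w ! i a < w ! i b \<longleftrightarrow> p ! a < p ! b)"

lemma occurrence_less_iff: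
  "occurrence w p i \<Longrightarrow> a < length p \<Longrightarrow> b < length p \<Longrightarrow> i a < i b \<longleftrightarrow> a < b"
  unfolding occurrence_def using strict_mono_on_less[of "{..<length p}" i a b] by simp

lemma occurrence_nth_less_iff:
  "occurrence w p i \<Longrightarrow> a < length p \<Longrightarrow> b < length p \<Longrightarrow> w ! i a < w ! i b \<longleftrightarrow> p ! a < p ! b"
  unfolding occurrence_def by blast

lemma occurrence_in_range: "occurrence w p i \<Longrightarrow> a < length p \<Longrightarrow> i a < length w"
  unfolding occurrence_def by blast

lemma card_occurrence: "occurrence w p i \<Longrightarrow> card (i ` {..<length p}) = length p"
  unfolding occurrence_def using card_image[OF strict_mono_on_imp_inj_on] by fastforce

text \<open>For reversed pairs the comparison follows from the given one because entries of
  permutations are distinct.\<close>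

lemma contains_pattern_iff_occurrence:
  assumes "w \<in> perms" "p \<in> perms"
  shows "contains_pattern w p \<longleftrightarrow> (\<exists>i. occurrence w p i)"
proof
  assume "contains_pattern w p"
  then obtain i where mono: "strict_mono_on {..<length p} i" and sub: "i ` {..<length p} \<subseteq> {..<length w}"
    and iso: "\<forall>a b. a < b \<and> b < length p \<longrightarrow> (w ! i a < w ! i b \<longleftrightarrow> p ! a < p ! b)"
    unfolding contains_pattern_def by blast
  have "w ! i a < w ! i b \<longleftrightarrow> p ! a < p ! b" if ab: "a < length p" "b < length p" for a b
  proof (cases a b rule: linorder_cases)
    case greater
    then have "i a \<noteq> i b"
      using strict_mono_on_less[OF mono, of b a] ab by simp
    moreover have "i a < length w" "i b < length w" using sub ab by auto
    ultimately have "w ! i a \<noteq> w ! i b" using nth_eq_iff_perms[OF assms(1)] by blast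
    moreover have "p ! a \<noteq> p ! b" using nth_eq_iff_perms[OF assms(2) ab] greater by simp
    moreover have "w ! i b < w ! i a \<longleftrightarrow> p ! b < p ! a" using iso greater ab by blast
    ultimately show ?thesis by linarith
  qed (use iso ab in auto)
  then show "\<exists>i. occurrence w p i"
    unfolding occurrence_def using mono sub by blast
next
  assume "\<exists>i. occurrence w p i"
  then show "contains_pattern w p"
    unfolding occurrence_def contains_pattern_def by (meson less_trans)
qed

lemma occurrence_trans:
  assumes e: "occurrence w q e" and l: "occurrence q p l"
  shows "occurrence w p (e \<circ> l)"
  unfolding occurrence_def
proof (intro conjI allI impI strict_mono_onI)
  note lr = occurrence_in_range[OF l]
  show "(e \<circ> l) a < (e \<circ> l) b" if "a \<in> {..<length p}" "b \<in> {..<length p}" "a < b" for a b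
    using that lr occurrence_less_iff[OF e, of "l a" "l b"] occurrence_less_iff[OF l, of a b] by simp
  show "(e \<circ> l) ` {..<length p} \<subseteq> {..<length w}"
    using lr occurrence_in_range[OF e] by auto
  show "w ! (e \<circ> l) a < w ! (e \<circ> l) b \<longleftrightarrow> p ! a < p ! b" if "a < length p" "b < length p" for a b
    using that lr occurrence_nth_less_iff[OF e, of "l a" "l b"] occurrence_nth_less_iff[OF l, of a b] by simp
qed

lemma occurrence_factor:
  assumes e: "occurrence w q e" and i: "occurrence w p i"
    and sub: "i ` {..<length p} \<subseteq> e ` {..<length q}"
  shows "\<exists>l. occurrence q p l"
proof -
  have "\<forall>a\<in>{..<length p}. \<exists>b. b < length q \<and> e b = i a"
    using sub by fastforce
  then obtain l where l: "\<And>a. a < length p \<Longrightarrow> l a < length q \<and> e (l a) = i a"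
    by (metis lessThan_iff)
  have "occurrence q p l"
    unfolding occurrence_def
  proof (intro conjI allI impI strict_mono_onI)
    show "l a < l b" if "a \<in> {..<length p}" "b \<in> {..<length p}" "a < b" for a b
      using that l occurrence_less_iff[OF e, of "l a" "l b"] occurrence_less_iff[OF i, of a b] by simp
    show "l ` {..<length p} \<subseteq> {..<length q}" using l by auto
    show "q ! l a < q ! l b \<longleftrightarrow> p ! a < p ! b" if "a < length p" "b < length p" for a b
      using that l occurrence_nth_less_iff[OF e, of "l a" "l b"] occurrence_nth_less_iff[OF i, of a b] by simp
  qed
  then show ?thesis by blast
qed

text \<open>This is standardization: each entry at a position of \<open>J\<close> is replaced by its
  rank among these entries.\<close>

lemma ex_pattern_at:
  assumes w: "w \<in> perms" and J: "J \<subseteq> {..<length w}" "J \<noteq> {}"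
  obtains q e where "q \<in> Sym (card J)" "q \<in> perms" "length q = card J" "occurrence w q e"
    "e ` {..<length q} = J"
proof -
  have fin: "finite J" using J(1) finite_subset by blast
  define e where "e = (!) (sorted_list_of_set J)"
  \<comment> \<open>Counting with \<open>\<le>\<close> includes the entry itself, so ranks start at
    1 as 1-line notation requires.\<close>
  define r where "r j = card {j' \<in> J. w ! j' \<le> w ! j}" for j
  define q where "q = map (\<lambda>a. r (e a)) [0..<card J]"
  have len: "length (sorted_list_of_set J) = card J" by simp
  have e_mono: "e a < e b" if "a < b" "b < card J" for a b
    unfolding e_def using strict_sorted_list_of_set[of J] that len
    by (metis sorted_wrt_iff_nth_less)
  have e_img: "e ` {..<card J} = J"
  proof -
    have "e ` {..<card J} = set (sorted_list_of_set J)"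
      unfolding e_def set_conv_nth len by auto
    then show ?thesis using fin by simp
  qed
  have r_less: "r j < r j'" if "j \<in> J" "j' \<in> J" "w ! j < w ! j'" for j j'
  proof -
    have "{i \<in> J. w ! i \<le> w ! j} \<subseteq> {i \<in> J. w ! i \<le> w ! j'} - {j'}"
      using that(3) by auto
    moreover have "j' \<in> {i \<in> J. w ! i \<le> w ! j'}" using that(2) by simp
    ultimately show ?thesis unfolding r_def using fin by (intro psubset_card_mono) auto
  qed
  have r_iff: "w ! j < w ! j' \<longleftrightarrow> r j < r j'" if "j \<in> J" "j' \<in> J" for j j'
  proof
    assume lt: "r j < r j'"
    then have "j \<noteq> j'" by auto
    then have "w ! j \<noteq> w ! j'" using nth_eq_iff_perms[OF w] that J(1) by blast
    then show "w ! j < w ! j'" using r_less[OF that(2,1)] lt by (cases "w ! j < w ! j'") auto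
  qed (rule r_less[OF that])
  have r_inj: "inj_on r J"
  proof
    fix j j' assume j: "j \<in> J" "j' \<in> J" "r j = r j'"
    then have "w ! j = w ! j'" using r_iff[of j j'] r_iff[of j' j] by simp
    then show "j = j'" using nth_eq_iff_perms[OF w] j J(1) by blast
  qed
  have "set q = r ` J"
    using e_img by (simp add: q_def lessThan_atLeast0 image_image[symmetric])
  moreover have "r ` J \<subseteq> {1..card J}"
  proof
    fix x assume "x \<in> r ` J"
    then obtain j where j: "j \<in> J" "x = r j" by blast
    then have "{j' \<in> J. w ! j' \<le> w ! j} \<noteq> {}" by blast
    then have "1 \<le> r j" unfolding r_def using fin by (simp add: Suc_le_eq card_gt_0_iff)
    moreover have "r j \<le> card J" unfolding r_def by (rule card_mono[OF fin]) auto
    ultimately show "x \<in> {1..card J}" using j by simp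
  qed
  moreover have "card (r ` J) = card J" by (rule card_image[OF r_inj])
  ultimately have set: "set q = {1..card J}"
    by (metis card_subset_eq card_atLeastAtMost diff_Suc_1 finite_atLeastAtMost)
  moreover have "distinct q"
    by (rule card_distinct) (simp only: set card_atLeastAtMost, simp add: q_def)
  ultimately have q: "q \<in> Sym (card J)" by (simp add: Sym_iff)
  have lenq: "length q = card J" by (simp add: q_def)
  have nthq: "q ! a = r (e a)" if "a < card J" for a
    using that by (simp add: q_def)
  have eJ: "e a \<in> J" if "a < card J" for a using e_img that by blast
  have "occurrence w q e"
    unfolding occurrence_def lenq
  proof (intro conjI allI impI strict_mono_onI)
    show "w ! e a < w ! e b \<longleftrightarrow> q ! a < q ! b" if "a < card J" "b < card J" for a b
      using r_iff[OF eJ[OF that(1)] eJ[OF that(2)]] by (simp add: nthq that)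
  qed (use e_mono e_img J(1) in auto)
  moreover have "1 \<le> card J" using J(2) fin by (simp add: Suc_le_eq card_gt_0_iff)
  ultimately show ?thesis
    using that q lenq e_img by (simp add: perms_iff)
qed

lemma Av_downward:
  assumes "w \<in> Av P" "P \<subseteq> perms" "p \<in> perms" "occurrence w p i"
  shows "p \<in> Av P"
proof -
  have "\<not> contains_pattern p r" if r: "r \<in> P" for r
  proof
    assume "contains_pattern p r"
    then obtain l where "occurrence p r l"
      using contains_pattern_iff_occurrence assms r by blast
    then have "occurrence w r (i \<circ> l)" by (rule occurrence_trans[OF assms(4)])
    then have "contains_pattern w r"
      using contains_pattern_iff_occurrence assms r unfolding Av_def by blast
    then show False using assms(1) r unfolding Av_def by blast
  qed
  then show ?thesis using assms(3) unfolding Av_def by blast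
qed

subsection \<open>Ideal patterns\<close>

text \<open>The convex hull in the dominance order. The weak inequalities put the points of
  \<open>I\<close> themselves into it.\<close>

definition dominance_hull :: "nat list \<Rightarrow> nat set \<Rightarrow> nat set" where
  "dominance_hull w I = {j. j < length w \<and> (\<exists>a\<in>I. \<exists>b\<in>I. a \<le> j \<and> j \<le> b \<and> w ! a \<le> w ! j \<and> w ! j \<le> w ! b)}"

lemma subset_dominance_hull: "I \<subseteq> {..<length w} \<Longrightarrow> I \<subseteq> dominance_hull w I"
  unfolding dominance_hull_def by blast

lemma dominance_hull_mono: "I \<subseteq> J \<Longrightarrow> dominance_hull w I \<subseteq> dominance_hull w J"
  unfolding dominance_hull_def by blast

text \<open>Whenever \<open>j\<close> serves as a lower or upper bound, a point of \<open>I\<close>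
  below or above \<open>j\<close> serves as well.\<close>

lemma dominance_hull_insert:
  assumes "j \<in> dominance_hull w I"
  shows "dominance_hull w (insert j I) = dominance_hull w I"
proof
  obtain a b where ab: "a \<in> I" "b \<in> I" "a \<le> j" "j \<le> b" "w ! a \<le> w ! j" "w ! j \<le> w ! b"
    using assms unfolding dominance_hull_def by blast
  show "dominance_hull w (insert j I) \<subseteq> dominance_hull w I"
  proof
    fix r assume "r \<in> dominance_hull w (insert j I)"
    then obtain x y where xy: "x \<in> insert j I" "y \<in> insert j I" "x \<le> r" "r \<le> y"
      "w ! x \<le> w ! r" "w ! r \<le> w ! y" and r: "r < length w"
      unfolding dominance_hull_def by blast
    have "\<exists>x'\<in>I. x' \<le> r \<and> w ! x' \<le> w ! r"
      using xy ab by (cases "x = j") (auto intro: order_trans)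
    moreover have "\<exists>y'\<in>I. r \<le> y' \<and> w ! r \<le> w ! y'"
      using xy ab by (cases "y = j") (auto intro: order_trans)
    ultimately show "r \<in> dominance_hull w I" using r unfolding dominance_hull_def by blast
  qed
qed (auto intro: dominance_hull_mono[THEN subsetD])

text \<open>Strict and weak inequalities are reconciled by distinctness of entries: a hull point
  outside \<open>I\<close> differs from its bounds in position and in value.\<close>

lemma dominance_convex_iff_hull:
  assumes w: "w \<in> perms" and I: "I \<subseteq> {..<length w}"
  shows "dominance_convex (perm_fun w) (Suc ` I) \<longleftrightarrow> dominance_hull w I \<subseteq> I"
proof
  assume cvx: "dominance_convex (perm_fun w) (Suc ` I)"
  show "dominance_hull w I \<subseteq> I"
  proof
    fix j assume "j \<in> dominance_hull w I"
    then obtain a b where j: "j < length w" and ab: "a \<in> I" "b \<in> I" "a \<le> j" "j \<le> b"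
      "w ! a \<le> w ! j" "w ! j \<le> w ! b"
      unfolding dominance_hull_def by blast
    show "j \<in> I"
    proof (rule ccontr)
      assume "j \<notin> I"
      then have neq: "a \<noteq> j" "j \<noteq> b" using ab by auto
      have len: "a < length w" "b < length w" using ab I by auto
      have "w ! a \<noteq> w ! j" "w ! j \<noteq> w ! b"
        using nth_eq_iff_perms[OF w] len j neq by auto
      then have "perm_fun w (Suc a) < perm_fun w (Suc j)" "perm_fun w (Suc j) < perm_fun w (Suc b)"
        using ab len j by (simp_all add: perm_fun_Suc)
      moreover have "Suc a < Suc j" "Suc j < Suc b" using ab neq by auto
      ultimately have "Suc j \<in> Suc ` I"
        using cvx ab(1,2) unfolding dominance_convex_def by blast
      then show False using \<open>j \<notin> I\<close> by auto
    qed
  qed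
next
  assume hull: "dominance_hull w I \<subseteq> I"
  show "dominance_convex (perm_fun w) (Suc ` I)"
    unfolding dominance_convex_def
  proof (intro ballI allI impI; elim conjE imageE)
    fix a' b' a b j
    assume ab: "a' < j" "j < b'" "perm_fun w a' < perm_fun w j" "perm_fun w j < perm_fun w b'"
      "a' = Suc a" "b' = Suc b" "a \<in> I" "b \<in> I"
    obtain r where r: "j = Suc r" using ab(1) by (cases j) auto
    have len: "a < length w" "b < length w" using ab I by auto
    moreover have *: "a \<le> r" "r \<le> b" using ab r by auto
    ultimately have "w ! a \<le> w ! r" "w ! r \<le> w ! b"
      using ab(3-6) r by (simp_all add: perm_fun_Suc)
    then have "r \<in> dominance_hull w I"
      using * ab(7,8) len unfolding dominance_hull_def by fastforce
    then show "j \<in> Suc ` I" using hull r by auto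
  qed
qed

section \<open>Factors versus convex occurrences for permutations in 1-line notation\<close>

lemma factor_contains_imp_occurrence:
  assumes w: "w \<in> perms" and h: "h \<in> perms" and fac: "factor_contains w h"
  obtains p l where "p \<in> Sym (length h)" "p \<in> perms" "factor_contains p h" "occurrence w p l"
    "dominance_hull w (l ` {..<length h}) \<subseteq> l ` {..<length h}"
proof -
  define k n where "k = length h" and "n = length w"
  have k: "1 \<le> k" using h by (simp add: perms_iff k_def)
  obtain x v y c where c: "k + c \<le> n" and v: "reduced_expression h v"
    and u: "reduced_expression w (x @ map (\<lambda>i. i + c) v @ y)"
    using fac unfolding factor_contains_def k_def n_def by blast
  have rv: "reduced_word k v" using v unfolding reduced_expression_iff[OF h] k_def by blast
  have ru: "reduced_word n (x @ map (\<lambda>i. i + c) v @ y)"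
    and F: "word_prod (x @ map (\<lambda>i. i + c) v @ y) = perm_fun w"
    using u unfolding reduced_expression_iff[OF w] n_def by blast+
  obtain \<alpha> \<beta> x' y' where \<alpha>: "strict_mono_on {1..k} \<alpha>" "\<alpha> ` {1..k} \<subseteq> {1..n}"
    and \<beta>: "strict_mono_on {1..k} \<beta>" and red: "reduced_word k (x' @ v @ y')"
    and eq: "\<forall>a\<in>{1..k}. perm_fun w (\<alpha> a) = \<beta> (word_prod (x' @ v @ y') a)"
    and cvx: "dominance_convex (perm_fun w) (\<alpha> ` {1..k})"
    using factor_convex_occurrence[OF ru rv c] unfolding F by blast
  have "word_prod (x' @ v @ y') permutes {1..k}"
    using red unfolding reduced_word_def by (blast intro: word_prod_permutes)
  then obtain p where p: "p \<in> Sym k" "p \<in> perms" "length p = k" "perm_fun p = word_prod (x' @ v @ y')"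
    using ex_perm_of_permutes k by blast
  \<comment> \<open>As \<open>p\<close> has the rank of \<open>h\<close>, the factor
    \<open>v\<close> sits in its word with shift 0.\<close>
  have "reduced_expression p (x' @ map (\<lambda>i. i + 0) v @ y')"
    unfolding reduced_expression_iff[OF p(2)] using red p by simp
  moreover have "length h + 0 \<le> length p" using p(3) by (simp add: k_def)
  ultimately have ph: "factor_contains p h"
    unfolding factor_contains_def using v by blast
  define l where "l a = \<alpha> (Suc a) - 1" for a
  have range: "\<alpha> (Suc a) \<in> {1..n}" if "a < k" for a
  proof -
    have "Suc a \<in> {1..k}" using that by simp
    then show ?thesis using \<alpha>(2) by blast
  qed
  have Suc_l: "Suc (l a) = \<alpha> (Suc a)" if "a < k" for a
    using range[OF that] by (simp add: l_def)
  have img: "Suc ` l ` {..<k} = \<alpha> ` {1..k}"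
  proof -
    have "Suc ` l ` {..<k} = \<alpha> ` Suc ` {..<k}"
      unfolding image_image by (rule image_cong) (simp_all add: Suc_l)
    then show ?thesis by (simp only: image_Suc_lessThan)
  qed
  have l_range: "l a < n" if "a < k" for a using range[OF that] Suc_l[OF that] by simp
  have nth: "w ! l a = \<beta> (p ! a)" if "a < k" for a
  proof -
    have "w ! l a = perm_fun w (\<alpha> (Suc a))"
      using l_range[OF that] Suc_l[OF that] perm_fun_Suc[of "l a" w] by (simp add: n_def)
    also have "\<dots> = \<beta> (perm_fun p (Suc a))" using eq that p(4) by simp
    finally show ?thesis using that p(3) by (simp add: perm_fun_Suc)
  qed
  have p_range: "p ! a \<in> {1..k}" if "a < k" for a
    using p(1,3) that nth_mem[of a p] unfolding Sym_iff by simp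
  have "occurrence w p l"
    unfolding occurrence_def p(3)
  proof (intro conjI allI impI strict_mono_onI)
    show "l a < l b" if "a \<in> {..<k}" "b \<in> {..<k}" "a < b" for a b
      using Suc_l[of a] Suc_l[of b] strict_mono_onD[OF \<alpha>(1), of "Suc a" "Suc b"] that by simp
    show "l ` {..<k} \<subseteq> {..<length w}" using l_range by (auto simp: n_def)
    show "w ! l a < w ! l b \<longleftrightarrow> p ! a < p ! b" if "a < k" "b < k" for a b
      unfolding nth[OF that(1)] nth[OF that(2)]
      by (rule strict_mono_on_less[OF \<beta> p_range[OF that(1)] p_range[OF that(2)]])
  qed
  moreover have "dominance_hull w (l ` {..<k}) \<subseteq> l ` {..<k}"
  proof -
    have "l ` {..<k} \<subseteq> {..<length w}" using l_range by (auto simp: n_def)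
    then show ?thesis
      using dominance_convex_iff_hull[OF w] cvx unfolding img[symmetric] by blast
  qed
  ultimately show ?thesis using that p ph unfolding k_def by blast
qed

lemma convex_occurrence_imp_factor_contains:
  assumes w: "w \<in> perms" and p: "p \<in> perms" and occ: "occurrence w p i"
    and cvx: "dominance_hull w (i ` {..<length p}) \<subseteq> i ` {..<length p}"
  shows "factor_contains w p"
proof -
  define k n where "k = length p" and "n = length w"
  define I where "I = Suc ` i ` {..<k}"
  let ?F = "perm_fun w" and ?P = "perm_fun p"
  have F: "?F permutes {1..n}" and P: "?P permutes {1..k}"
    using perm_fun_permutes w p by (simp_all add: k_def n_def)
  obtain u where ru: "reduced_word k u" and prod_u: "word_prod u = ?P"
    using ex_reduced_word[OF P] by blast
  have i_range: "i a < n" if "a < k" for a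
    using occurrence_in_range[OF occ] that by (simp add: k_def n_def)
  then have I_sub: "I \<subseteq> {1..n}" unfolding I_def by (auto simp: Suc_le_eq)
  have dc: "dominance_convex ?F I"
    using cvx dominance_convex_iff_hull[OF w, of "i ` {..<k}"] i_range unfolding I_def k_def n_def by blast
  define \<alpha> where "\<alpha> a = Suc (i (a - 1))" for a
  \<comment> \<open>\<open>inv ?P b\<close> is the index at which the pattern has the value
    \<open>b\<close>, so \<open>\<beta>\<close> lists the values of the occurrence in increasing
    order.\<close>
  define \<beta> where "\<beta> b = ?F (\<alpha> (inv ?P b))" for b
  have \<alpha>_img: "\<alpha> ` {1..k} = I"
  proof -
    have "\<alpha> ` Suc ` {..<k} = I"
      unfolding I_def image_image by (rule image_cong) (simp_all add: \<alpha>_def)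
    then show ?thesis by (simp only: image_Suc_lessThan)
  qed
  have iso: "?F (\<alpha> a) < ?F (\<alpha> b) \<longleftrightarrow> ?P a < ?P b" if "a \<in> {1..k}" "b \<in> {1..k}" for a b
  proof -
    have eqs: "?F (\<alpha> a) = w ! i (a - 1)" "?P a = p ! (a - 1)" if "a \<in> {1..k}" for a
    proof -
      have "a - 1 < k" "a = Suc (a - 1)" using that by auto
      then show "?F (\<alpha> a) = w ! i (a - 1)" "?P a = p ! (a - 1)"
        using perm_fun_Suc[of "i (a - 1)" w] perm_fun_Suc[of "a - 1" p] i_range[of "a - 1"]
        by (simp_all add: \<alpha>_def k_def n_def)
    qed
    have "a - 1 < length p" "b - 1 < length p" using that by (auto simp: k_def)
    then show ?thesis
      unfolding eqs[OF that(1)] eqs[OF that(2)] by (rule occurrence_nth_less_iff[OF occ])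
  qed
  \<comment> \<open>The labels put the points below the block first, then the block, then all other
    points. Within the outer two groups positions serve as labels: they are distinct and compatible
    with dominance, and the offset \<open>Suc n\<close> separates the groups.\<close>
  define L where "L = {a \<in> {1..n} - I. \<exists>b\<in>I. a < b \<and> ?F a < ?F b}"
  define lab where "lab a = (if a \<in> L then a else if a \<in> I then Suc n else Suc n + a)" for a
  have LI: "a \<notin> I" if "a \<in> L" for a using that by (simp add: L_def)
  have Ln: "a \<le> n" if "a \<in> L" for a using that by (simp add: L_def)
  obtain x' y' d where d: "k + d \<le> n" and red: "reduced_word n (x' @ map (\<lambda>i. i + d) u @ y')"
    and prod: "word_prod (x' @ map (\<lambda>i. i + d) u @ y') = ?F"
  proof -
    have "\<exists>x' y' d. k + d \<le> n \<and> reduced_word n (x' @ map (\<lambda>i. i + d) u @ y') \<and>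
      word_prod (x' @ map (\<lambda>i. i + d) u @ y') = ?F"
    proof (rule convex_occurrence_factor[where lab = lab and m = "Suc n" and \<alpha> = \<alpha> and \<beta> = \<beta>])
      show "lab a \<le> lab b" if ab: "a \<in> {1..n}" "b \<in> {1..n}" "a < b" "?F a < ?F b" for a b
      proof -
        \<comment> \<open>\<open>L\<close> together with the block is closed downwards in the
          dominance order.\<close>
        have down: "a \<in> L \<or> a \<in> I" if "b \<in> L \<or> b \<in> I"
        proof -
          have "\<exists>e\<in>I. a < e \<and> ?F a < ?F e"
            using that ab unfolding L_def by (blast intro: less_trans)
          then show ?thesis using ab(1) unfolding L_def by blast
        qed
        \<comment> \<open>A point of \<open>L\<close> above a block point would lie between two
          block points, against convexity.\<close>
        have "b \<notin> L" if "a \<in> I"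
          using that dc ab LI unfolding L_def dominance_convex_def by blast
        then show ?thesis
          using down ab(1-3) Ln[of a] Ln[of b] by (auto simp: lab_def)
      qed
      show "lab a = Suc n" if "a \<in> {1..n}" "b \<in> {1..n}" "lab a = lab b" "a \<noteq> b" for a b
        using that Ln[of a] Ln[of b] by (auto simp: lab_def split: if_splits)
      show "strict_mono_on {1..k} \<alpha>"
      proof (rule strict_mono_onI)
        fix a b assume "a \<in> {1..k}" "b \<in> {1..k}" "a < b"
        then show "\<alpha> a < \<alpha> b"
          using occurrence_less_iff[OF occ, of "a - 1" "b - 1"] by (auto simp: \<alpha>_def k_def)
      qed
      have "{a \<in> {1..n}. lab a = Suc n} = I"
        using LI Ln[of "Suc n"] I_sub by (auto simp: lab_def split: if_splits)
      then show "\<alpha> ` {1..k} = {a \<in> {1..n}. lab a = Suc n}" using \<alpha>_img by simp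
      show "strict_mono_on {1..k} \<beta>"
      proof (rule strict_mono_onI)
        fix a b assume ab: "a \<in> {1..k}" "b \<in> {1..k}" "a < b"
        then have "inv ?P a \<in> {1..k}" "inv ?P b \<in> {1..k}"
          using permutes_in_image[OF permutes_inv[OF P]] by blast+
        then show "\<beta> a < \<beta> b"
          unfolding \<beta>_def using iso ab(3) by (simp only: permutes_inverses[OF P])
      qed
      show "?F (\<alpha> a) = \<beta> (word_prod u a)" for a
        unfolding prod_u \<beta>_def by (simp only: permutes_inverses[OF P])
    qed (rule F ru)+
    then show ?thesis using that by blast
  qed
  have "reduced_expression w (x' @ map (\<lambda>i. i + d) u @ y')"
    unfolding reduced_expression_iff[OF w] using red prod by (simp only: n_def)
  moreover have "reduced_expression p u"
    unfolding reduced_expression_iff[OF p] using ru prod_u by (simp only: k_def)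
  ultimately show ?thesis
    unfolding factor_contains_def using d by (auto simp: k_def n_def)
qed

text \<open>The reduced word of \<open>p\<close> inside that of \<open>w\<close> may be replaced by
  any other reduced word of \<open>p\<close>, in particular by one exhibiting \<open>h\<close>; the
  two shifts add up.\<close>

lemma factor_contains_trans:
  assumes w: "w \<in> perms" and p: "p \<in> perms" and wp: "factor_contains w p" and ph: "factor_contains p h"
  shows "factor_contains w h"
proof -
  obtain x v y c where c: "length p + c \<le> length w" and v: "reduced_expression p v"
    and xvy: "reduced_expression w (x @ map (\<lambda>i. i + c) v @ y)"
    using wp unfolding factor_contains_def by blast
  have red_w: "reduced_word (length w) (x @ map (\<lambda>i. i + c) v @ y)"
    and prod_w: "word_prod (x @ map (\<lambda>i. i + c) v @ y) = perm_fun w"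
    using xvy unfolding reduced_expression_iff[OF w] by blast+
  obtain x' v' y' c' where c': "length h + c' \<le> length p" and v': "reduced_expression h v'"
    and u: "reduced_expression p (x' @ map (\<lambda>i. i + c') v' @ y')"
    using ph unfolding factor_contains_def by blast
  define u where "u = x' @ map (\<lambda>i. i + c') v' @ y'"
  have red: "reduced_word (length p) u" "reduced_word (length p) v" and prod: "word_prod u = word_prod v"
    using u v unfolding u_def reduced_expression_iff[OF p] by auto
  then have pos: "0 \<notin> set u" "0 \<notin> set v" and len: "length u = length v"
    by (auto simp: reduced_word_def)
  have "word_prod (map (\<lambda>i. i + c) u) = word_prod (map (\<lambda>i. i + c) v)"
    using word_prod_shift_inject[OF pos] prod by blast
  then have eq: "word_prod (x @ map (\<lambda>i. i + c) u @ y) = word_prod (x @ map (\<lambda>i. i + c) v @ y)"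
    by (simp only: word_prod_append)
  have "set (map (\<lambda>i. i + c) u) \<subseteq> {1..<length w}"
    using red(1) c by (force simp: reduced_word_def)
  then have "reduced_expression w (x @ map (\<lambda>i. i + c) u @ y)"
    using red_w len unfolding reduced_expression_iff[OF w] reduced_word_def eq prod_w by simp
  moreover have "x @ map (\<lambda>i. i + c) u @ y =
    (x @ map (\<lambda>i. i + c) x') @ map (\<lambda>i. i + (c' + c)) v' @ (map (\<lambda>i. i + c) y' @ y)"
    by (simp add: u_def add.assoc)
  moreover have "length h + (c' + c) \<le> length w" using c c' by simp
  ultimately show ?thesis
    unfolding factor_contains_def using v' by metis
qed

text \<open>Induction on the size of the hull in \<open>w\<close>, with the pattern varying over
  \<open>U P h\<close> along with its occurrence.\<close>

lemma ex_convex_occurrence: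
  assumes P: "P \<subseteq> perms" and w: "w \<in> Av P"
    and ideal: "\<forall>p\<in>U P h. ideal_pattern P p"
    and "p \<in> U P h" "occurrence w p i"
  obtains p' i' where "p' \<in> U P h" "occurrence w p' i'"
    "dominance_hull w (i' ` {..<length p'}) \<subseteq> i' ` {..<length p'}"
proof -
  have wp: "w \<in> perms" using w by (simp add: Av_def)
  have "\<exists>p' i'. p' \<in> U P h \<and> occurrence w p' i' \<and> dominance_hull w (i' ` {..<length p'}) \<subseteq> i' ` {..<length p'}"
    using assms(4,5)
  proof (induction "card (dominance_hull w (i ` {..<length p}))" arbitrary: p i rule: less_induct)
    case less
    note pU = less.prems(1) and occ = less.prems(2)
    define I where "I = i ` {..<length p}"
    have pp: "p \<in> perms" and len: "length p = length h" and heap: "heap_contains p h"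
      using pU length_Sym unfolding U_def Av_def by auto
    have ph: "factor_contains p h"
      using heap heap_contains_iff_factor_contains pp unfolding perms_iff by blast
    have I_sub: "I \<subseteq> {..<length w}" using occ unfolding occurrence_def I_def by blast
    have I_card: "card I = length p" unfolding I_def by (rule card_occurrence[OF occ])
    have fin: "finite I" unfolding I_def by simp
    show ?case
    proof (cases "dominance_hull w I \<subseteq> I")
      case True
      then show ?thesis using pU occ unfolding I_def by blast
    next
      case False
      then obtain j where j: "j \<in> dominance_hull w I" "j \<notin> I" by blast
      \<comment> \<open>Only one hull point is added, so that the pattern at \<open>J\<close> has
        exactly the length to which ideality of \<open>p\<close> applies.\<close>
      define J where "J = insert j I"
      have J_sub: "J \<subseteq> {..<length w}" using I_sub j unfolding J_def dominance_hull_def by blast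
      have J_card: "card J = Suc (length p)" using j(2) fin I_card unfolding J_def by simp
      have J_ne: "J \<noteq> {}" unfolding J_def by blast
      obtain q e where q: "q \<in> Sym (card J)" "q \<in> perms" "length q = card J" "occurrence w q e"
        "e ` {..<length q} = J"
        using ex_pattern_at[OF wp J_sub J_ne] by blast
      have qAv: "q \<in> Av P" by (rule Av_downward[OF w P q(2,4)])
      have "i ` {..<length p} \<subseteq> e ` {..<length q}"
        unfolding q(5) J_def I_def by blast
      then have "contains_pattern q p"
        using occurrence_factor[OF q(4) occ] contains_pattern_iff_occurrence[OF q(2) pp] by blast
      moreover have "q \<in> Av P \<inter> Sym (length p + 1)" using qAv q(1) unfolding J_card by simp
      ultimately have "heap_contains q p"
        using ideal pU unfolding ideal_pattern_def by blast
      then have "factor_contains q p"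
        using heap_contains_iff_factor_contains q(2) unfolding perms_iff by blast
      then obtain p' l where p': "p' \<in> Sym (length p)" "p' \<in> perms" "factor_contains p' p"
        "occurrence q p' l" "dominance_hull q (l ` {..<length p}) \<subseteq> l ` {..<length p}"
        using factor_contains_imp_occurrence[OF q(2) pp] by metis
      have len': "length p' = length p" using p'(1) by (rule length_Sym)
      have occ': "occurrence w p' (e \<circ> l)" by (rule occurrence_trans[OF q(4) p'(4)])
      define I' where "I' = (e \<circ> l) ` {..<length p'}"
      have p'Av: "p' \<in> Av P" by (rule Av_downward[OF w P p'(2) occ'])
      \<comment> \<open>This step returns to \<open>U P h\<close>: \<open>p'\<close> may differ from
        \<open>p\<close>, but it has the same rank and inherits \<open>h\<close> through
        \<open>p\<close>.\<close>
      have "factor_contains p' h"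
        by (rule factor_contains_trans[OF p'(2) pp p'(3) ph])
      then have "heap_contains p' h"
        using heap_contains_iff_factor_contains p'(2) unfolding perms_iff by blast
      then have p'U: "p' \<in> U P h"
        unfolding U_def using p'Av p'(1) len by simp
      have l_range: "l a < length q" if "a < length p" for a
        using occurrence_in_range[OF p'(4)] that len' by simp
      have I'J: "I' \<subseteq> J"
        unfolding I'_def q(5)[symmetric] using l_range len' by auto
      have I'_card: "card I' = length p"
        unfolding I'_def using card_occurrence[OF occ'] len' by simp
      then have "I' \<noteq> J" using J_card by auto
      then obtain j' where j': "j' \<in> J" "j' \<notin> I'" using I'J by blast
      have "dominance_hull w I' \<subseteq> dominance_hull w I"
        using dominance_hull_mono[OF I'J] dominance_hull_insert[OF j(1)] unfolding J_def by blast
      moreover have "j' \<in> dominance_hull w I"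
        using subset_dominance_hull[OF I_sub] j(1) j'(1) unfolding J_def by blast
      \<comment> \<open>The omitted point leaves the hull: \<open>e\<close> transports the
        inequalities around \<open>j'\<close> back to \<open>q\<close>, where the occurrence of
        \<open>p'\<close> is convex.\<close>
      moreover have "j' \<notin> dominance_hull w I'"
      proof
        assume "j' \<in> dominance_hull w I'"
        then obtain a b where ab: "a < length p" "b < length p" and le: "e (l a) \<le> j'" "j' \<le> e (l b)"
          "w ! e (l a) \<le> w ! j'" "w ! j' \<le> w ! e (l b)"
          unfolding dominance_hull_def I'_def len' by auto
        obtain r where r: "r < length q" "j' = e r" using j'(1) unfolding q(5)[symmetric] by blast
        have "l a \<le> r" "r \<le> l b" "q ! l a \<le> q ! r" "q ! r \<le> q ! l b"
          using le l_range[OF ab(1)] l_range[OF ab(2)] r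
            occurrence_less_iff[OF q(4)] occurrence_nth_less_iff[OF q(4)]
          by (simp_all add: not_less[symmetric])
        then have "r \<in> dominance_hull q (l ` {..<length p})"
          using ab r(1) unfolding dominance_hull_def by blast
        then have "r \<in> l ` {..<length p}" using p'(5) by blast
        then have "j' \<in> I'" unfolding I'_def len' r(2) by auto
        then show False using j'(2) by blast
      qed
      ultimately have "dominance_hull w I' \<subset> dominance_hull w I" by blast
      moreover have "finite (dominance_hull w I)" unfolding dominance_hull_def by simp
      ultimately have "card (dominance_hull w I') < card (dominance_hull w I)" by (rule psubset_card_mono[rotated])
      then show ?thesis
        using less.hyps[OF _ p'U occ'] unfolding I'_def I_def by blast
    qed
  qed
  then show ?thesis using that by blast
qed

theorem theorem4p4:
  fixes P H :: "nat list set"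
  assumes "finite P" and "P \<subseteq> perms"
    and "finite H" and "H \<subseteq> perms"
    and "\<forall>p \<in> (\<Union>h\<in>H. U P h). ideal_pattern P p"
  shows "heap_Av P H = Av (P \<union> (\<Union>h\<in>H. U P h))"
proof -
  have U_perms: "p \<in> perms" if "p \<in> U P h" for p h
    using that unfolding U_def Av_def by blast
  have iff: "(\<exists>h\<in>H. heap_contains w h) \<longleftrightarrow> (\<exists>h\<in>H. \<exists>p\<in>U P h. contains_pattern w p)" if w: "w \<in> Av P" for w
  proof -
    have wp: "w \<in> perms" using w by (simp add: Av_def)
    have heap_iff: "heap_contains v h \<longleftrightarrow> factor_contains v h" if "v \<in> perms" for v h
      using that heap_contains_iff_factor_contains unfolding perms_iff by blast
    have "heap_contains w h \<longleftrightarrow> (\<exists>p\<in>U P h. contains_pattern w p)" if hH: "h \<in> H" for h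
    proof
      have h: "h \<in> perms" using hH assms(4) by blast
      assume "heap_contains w h"
      then obtain p l where p: "p \<in> Sym (length h)" "p \<in> perms" "factor_contains p h" "occurrence w p l"
        using factor_contains_imp_occurrence[OF wp h] heap_iff[OF wp] by metis
      \<comment> \<open>Patterns contained in \<open>w\<close> inherit avoidance of
        \<open>P\<close>, which supplies the remaining condition for membership in
        \<open>U P h\<close>.\<close>
      then have "p \<in> U P h"
        unfolding U_def using heap_iff[OF p(2)] Av_downward[OF w assms(2) p(2,4)] by blast
      then show "\<exists>p\<in>U P h. contains_pattern w p"
        using p(4) contains_pattern_iff_occurrence[OF wp p(2)] by blast
    next
      assume "\<exists>p\<in>U P h. contains_pattern w p"
      then obtain p i where p: "p \<in> U P h" "occurrence w p i"
        using contains_pattern_iff_occurrence[OF wp U_perms] by blast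
      have ideal: "\<forall>p\<in>U P h. ideal_pattern P p" using assms(5) hH by blast
      obtain p' i' where p': "p' \<in> U P h" "occurrence w p' i'"
        "dominance_hull w (i' ` {..<length p'}) \<subseteq> i' ` {..<length p'}"
        using ex_convex_occurrence[OF assms(2) w ideal p] by metis
      have "factor_contains p' h"
        using p'(1) heap_iff[OF U_perms[OF p'(1)]] unfolding U_def by blast
      then have "factor_contains w h"
        using factor_contains_trans[OF wp U_perms[OF p'(1)]]
          convex_occurrence_imp_factor_contains[OF wp U_perms[OF p'(1)] p'(2,3)] by blast
      then show "heap_contains w h" using heap_iff[OF wp] by blast
    qed
    then show ?thesis by blast
  qed
  have "heap_Av P H = {w \<in> Av P. \<not> (\<exists>h\<in>H. heap_contains w h)}"
    unfolding heap_Av_def by blast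
  also have "\<dots> = {w \<in> Av P. \<not> (\<exists>h\<in>H. \<exists>p\<in>U P h. contains_pattern w p)}"
    using iff by blast
  also have "\<dots> = Av (P \<union> (\<Union>h\<in>H. U P h))"
    unfolding Av_def by blast
  finally show ?thesis .
qed

end
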